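(* Let $\mathfrak{a}, \mathfrak{b} \in \langle \Sigma \rangle$. Then \[ \Delta(\mathfrak{a}\sqcup\!\sqcup \mathfrak{b})=\Delta(\mathfrak{a})\sqcup\!\sqcup\Delta(\mathfrak{b}). \]
   Context: Let $\mathbb F_q$ be the finite field with $q$ elements, of characteristic $p$. Let $\Sigma=\{x_n\}_{n\geq 1}$ be an alphabet with weight $w(x_n)=n$; let $\langle\Sigma\rangle$ be the set of words over $\Sigma$ (the empty word is denoted $1$; the weight of a word is the sum of the weights of its letters), and let $\mathfrak C=\mathbb F_q\langle\Sigma\rangle$ be the $\mathbb F_q$-vector space with basis $\langle\Sigma\rangle$, equipped with concatenation. A nonempty word is written $\mathfrak a=x_a\mathfrak a_-$, where $x_a$ is its first letter. For $a,b,i\in\mathbb N$ put $\Delta^i_{a,b}=(-1)^{a-1}\binom{i-1}{a-1}+(-1)^{b-1}\binom{i-1}{b-1}\in\mathbb F_p$ if $(q-1)\mid i$ and $0<i<a+b$, and $\Delta^i_{a,b}=0$ otherwise. Define $\mathbb F_q$-bilinear products $\diamond$ (diamond) and $\sqcup\!\sqcup$ (shuffle) on $\mathfrak C$ recursively by $1\diamond\mathfrak a=\mathfrak a\diamond 1=\mathfrak a$, $1\sqcup\!\sqcup\mathfrak a=\mathfrak a\sqcup\!\sqcup 1=\mathfrak a$, and for nonempty words $\mathfrak a,\mathfrak b$: $\mathfrak a\diamond\mathfrak b=x_{a+b}(\mathfrak a_-\sqcup\!\sqcup\mathfrak b_-)+\sum_{i+j=a+b}\Delta^j_{a,b}\,x_i(x_j\sqcup\!\sqcup(\mathfrak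 a_-\sqcup\!\sqcup\mathfrak b_-))$, $\mathfrak a\sqcup\!\sqcup\mathfrak b=x_a(\mathfrak a_-\sqcup\!\sqcup\mathfrak b)+x_b(\mathfrak a\sqcup\!\sqcup\mathfrak b_-)+\mathfrak a\diamond\mathfrak b$ (a commutative associative product). The triangle product is $1\triangleright\mathfrak a=\mathfrak a\triangleright 1=\mathfrak a$ and $\mathfrak a\triangleright\mathfrak b=x_a(\mathfrak a_-\sqcup\!\sqcup\mathfrak b)$ for nonempty $\mathfrak a,\mathfrak b$. On $\mathfrak C\otimes\mathfrak C$ the shuffle product is taken componentwise: $(\mathfrak a_1\otimes\mathfrak b_1)\sqcup\!\sqcup(\mathfrak a_2\otimes\mathfrak b_2)=(\mathfrak a_1\sqcup\!\sqcup\mathfrak a_2)\otimes(\mathfrak b_1\sqcup\!\sqcup\mathfrak b_2)$. The coproduct $\Delta:\mathfrak C\to\mathfrak C\otimes\mathfrak C$ is the $\mathbb F_q$-linear map defined on words by induction on weight: $\Delta(1)=1\otimes 1$, $\Delta(x_1)=1\otimes x_1+x_1\otimes 1$; if $\mathfrak u=x_u\mathfrak v$ has depth $>1$ and $\Delta(x_u)=1\otimes x_u+\sum a_u\otimes b_u$, $\Delta(\mathfrak v)=\sum a_{\mathfrak v}\otimes b_{\mathfrak v}$, then $\Delta(\mathfrak u)=1\otimes\mathfrak u+\sum(a_u\triangleright a_{\mathfrak v})\otimes(b_u\sqcup\!\sqcup b_{\mathfrak v})$; and for $w\geq 2$, $\Delta(x_w)=\Delta(x_1)\sqcup\!\sqcup\Delta(x_{w-1})-\Delta(x_1x_{w-1})-\Delta(x_{w-1}x_1)-\sum_{0<j<w}\Delta^j_{1,w-1}\Delta(x_{w-j}x_j)$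 (mirroring $x_1\sqcup\!\sqcup x_{w-1}=x_w+x_1x_{w-1}+x_{w-1}x_1+\sum_{0<j<w}\Delta^j_{1,w-1}x_{w-j}x_j$). *)

theory Defs
  imports "HOL-Library.Poly_Mapping" "HOL-Library.Cardinality"
begin

text \<open>
  The letter \<open>x\<^sub>n\<close> is represented by the natural number \<open>n\<close>, so the words over
  \<open>\<Sigma> = {x\<^sub>n | n \<ge> 1}\<close> are the lists of positive naturals. The field with \<open>q\<close> elements is a
  type \<open>'a\<close> of sort \<open>{finite, field}\<close> with \<open>q = CARD('a)\<close>. The space with a given
  basis is the type of finitely supported functions on that basis; the tensor square is the space
  with basis the pairs of words.
\<close>

type_synonym word = "nat list"
type_synonym 'a wordspace = "word \<Rightarrow>\<^sub>0 'a"
type_synonym 'a tensorspace = "(word \<times> word) \<Rightarrow>\<^sub>0 'a"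

definition words :: "word set" where
  "words = {u. \<forall>n \<in> set u. 1 \<le> n}"

definition basis :: "'x \<Rightarrow> ('x \<Rightarrow>\<^sub>0 'a::field)" where
  "basis u = Poly_Mapping.single u 1"

definition smul :: "'a::field \<Rightarrow> ('x \<Rightarrow>\<^sub>0 'a) \<Rightarrow> ('x \<Rightarrow>\<^sub>0 'a)" where
  "smul c p = Poly_Mapping.map (\<lambda>x. c * x) p"

definition linext :: "('x \<Rightarrow> ('y \<Rightarrow>\<^sub>0 'a)) \<Rightarrow> ('x \<Rightarrow>\<^sub>0 'a::field) \<Rightarrow> ('y \<Rightarrow>\<^sub>0 'a)" where
  "linext f p = (\<Sum>u \<in> Poly_Mapping.keys p. smul (Poly_Mapping.lookup p u) (f u))"

definition bilinext ::
    "('x \<Rightarrow> 'y \<Rightarrow> ('z \<Rightarrow>\<^sub>0 'a)) \<Rightarrow> ('x \<Rightarrow>\<^sub>0 'a::field) \<Rightarrow> ('y \<Rightarrow>\<^sub>0 'a) \<Rightarrow> ('z \<Rightarrow>\<^sub>0 'a)" where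
  "bilinext f p r = linext (\<lambda>u. linext (\<lambda>v. f u v) r) p"

lemma linext_cong [fundef_cong]:
  assumes "p = r" and "\<And>u. u \<in> Poly_Mapping.keys r \<Longrightarrow> f u = g u"
  shows "linext f p = linext g r"
  using assms by (simp add: linext_def)

definition prepend :: "nat \<Rightarrow> 'a::field wordspace \<Rightarrow> 'a wordspace" where
  "prepend n = linext (\<lambda>u. basis (n # u))"

text \<open>\<open>delta_coeff a b i\<close> is \<open>\<Delta>\<^sup>i\<close> with lower indices \<open>a, b\<close>.\<close>

definition delta_coeff :: "nat \<Rightarrow> nat \<Rightarrow> nat \<Rightarrow> 'a::{finite,field}" where
  "delta_coeff a b i =
     (if (CARD('a) - 1) dvd i \<and> 0 < i \<and> i < a + b
      then (-1) ^ (a - 1) * of_nat ((i - 1) choose (a - 1))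
         + (-1) ^ (b - 1) * of_nat ((i - 1) choose (b - 1))
      else 0)"

lemma keys_smul: "Poly_Mapping.keys (smul c p) \<subseteq> Poly_Mapping.keys p"
  unfolding smul_def by (transfer) (auto simp: when_def)

lemma keys_linext:
  "Poly_Mapping.keys (linext f p) \<subseteq> (\<Union>u \<in> Poly_Mapping.keys p. Poly_Mapping.keys (f u))"
proof -
  have "Poly_Mapping.keys (linext f p)
      \<subseteq> (\<Union>u \<in> Poly_Mapping.keys p. Poly_Mapping.keys (smul (Poly_Mapping.lookup p u) (f u)))"
    unfolding linext_def by (rule keys_sum)
  then show ?thesis using keys_smul by fastforce
qed

lemma keys_basis: "Poly_Mapping.keys (basis u :: 'x \<Rightarrow>\<^sub>0 'a::field) = {u}"
  by (simp add: basis_def)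

lemma keys_prepend: "Poly_Mapping.keys (prepend n p) \<subseteq> (#) n ` Poly_Mapping.keys p"
  unfolding prepend_def using keys_linext[of "\<lambda>u. basis (n # u)" p] by (auto simp: keys_basis)

function diamond_word :: "word \<Rightarrow> word \<Rightarrow> 'a::{finite,field} wordspace"
  and shuffle_word :: "word \<Rightarrow> word \<Rightarrow> 'a wordspace" where
  "diamond_word [] v = basis v"
| "diamond_word (a # u) [] = basis (a # u)"
| "diamond_word (a # u) (b # v) =
     prepend (a + b) (shuffle_word u v)
     + (\<Sum>j \<in> {1..<a + b}. smul (delta_coeff a b j)
          (prepend (a + b - j) (linext (\<lambda>c. shuffle_word [j] c) (shuffle_word u v))))"
| "shuffle_word [] v = basis v"
| "shuffle_word (a # u) [] = basis (a # u)"
| "shuffle_word (a # u) (b # v) =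
     prepend a (shuffle_word u (b # v)) + prepend b (shuffle_word (a # u) v)
     + diamond_word (a # u) (b # v)"
  by pat_completeness auto

text \<open>The recursion is nested; it terminates since neither product raises the total length.\<close>

lemma keys_length_partial:
  "diamond_word_shuffle_word_dom TYPE('a::{finite,field}) (Inl (u, v)) \<Longrightarrow>
     \<forall>c \<in> Poly_Mapping.keys (diamond_word u v :: 'a wordspace). length c \<le> length u + length v"
  "diamond_word_shuffle_word_dom TYPE('a) (Inr (u, v)) \<Longrightarrow>
     \<forall>c \<in> Poly_Mapping.keys (shuffle_word u v :: 'a wordspace). length c \<le> length u + length v"
proof (induction u v and u v rule: diamond_word_shuffle_word.pinduct)
  case (3 a u b v)
  let ?K = "Poly_Mapping.keys :: 'a wordspace \<Rightarrow> word set"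
  let ?s = "shuffle_word u v :: 'a wordspace"
  let ?t = "\<lambda>j. prepend (a + b - j) (linext (\<lambda>c. shuffle_word [j] c) ?s)"
  have s: "length c \<le> length u + length v" if "c \<in> ?K ?s" for c
    using 3(2) that by blast
  have head: "length c \<le> Suc (length u + length v)" if "c \<in> ?K (prepend (a + b) ?s)" for c
    using subsetD[OF keys_prepend that] s by auto
  have tail: "length c \<le> Suc (Suc (length u + length v))"
    if j: "j \<in> {1..<a + b}" and c: "c \<in> ?K (smul (delta_coeff a b j) (?t j))" for j c
  proof -
    have "c \<in> ?K (?t j)" by (rule subsetD[OF keys_smul c])
    from subsetD[OF keys_prepend this] obtain d where d: "d \<in> ?K (linext (\<lambda>c. shuffle_word [j] c) ?s)"
      and cd: "c = (a + b - j) # d"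
      by blast
    obtain e where e: "e \<in> ?K ?s" and de: "d \<in> ?K (shuffle_word [j] e)"
      using subsetD[OF keys_linext d] by blast
    have "length d \<le> length [j] + length e" using 3(4)[OF j e] de by blast
    then show ?thesis using s[OF e] cd by simp
  qed
  show ?case
  proof
    fix c assume "c \<in> ?K (diamond_word (a # u) (b # v))"
    then have "c \<in> ?K (prepend (a + b) ?s
        + (\<Sum>j \<in> {1..<a + b}. smul (delta_coeff a b j) (?t j)))"
      using diamond_word.psimps(3)[OF 3(1)] by simp
    then have "c \<in> ?K (prepend (a + b) ?s)
        \<or> c \<in> ?K (\<Sum>j \<in> {1..<a + b}. smul (delta_coeff a b j) (?t j))"
      by (blast dest: subsetD[OF Poly_Mapping.keys_add])
    then show "length c \<le> length (a # u) + length (b # v)"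
    proof
      assume "c \<in> ?K (prepend (a + b) ?s)"
      then show ?thesis using head by fastforce
    next
      assume "c \<in> ?K (\<Sum>j \<in> {1..<a + b}. smul (delta_coeff a b j) (?t j))"
      then obtain j where "j \<in> {1..<a + b}" "c \<in> ?K (smul (delta_coeff a b j) (?t j))"
        by (blast dest: subsetD[OF keys_sum])
      then show ?thesis using tail by fastforce
    qed
  qed
next
  case (6 a u b v)
  let ?K = "Poly_Mapping.keys :: 'a wordspace \<Rightarrow> word set"
  show ?case
  proof
    fix c assume "c \<in> ?K (shuffle_word (a # u) (b # v))"
    then have "c \<in> ?K (prepend a (shuffle_word u (b # v)) + prepend b (shuffle_word (a # u) v)
        + diamond_word (a # u) (b # v))"
      using shuffle_word.psimps(3)[OF 6(1)] by simp
    then consider "c \<in> ?K (prepend a (shuffle_word u (b # v)))"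
      | "c \<in> ?K (prepend b (shuffle_word (a # u) v))"
      | "c \<in> ?K (diamond_word (a # u) (b # v))"
      by (blast dest: subsetD[OF Poly_Mapping.keys_add])
    then show "length c \<le> length (a # u) + length (b # v)"
    proof cases
      case 1 then show ?thesis using subsetD[OF keys_prepend 1] 6(2) by fastforce
    next
      case 2 then show ?thesis using subsetD[OF keys_prepend 2] 6(3) by fastforce
    next
      case 3 then show ?thesis using 6(4) by blast
    qed
  qed
qed (simp_all add: diamond_word.psimps shuffle_word.psimps keys_basis)

termination
proof (relation "measure (\<lambda>x. case x of Inl (u, v) \<Rightarrow> 2 * (length u + length v)
    | Inr (u, v) \<Rightarrow> 2 * (length u + length v) + 1)", goal_cases)
  case (4 a u b v j c)
  then have "length c \<le> length u + length v" using keys_length_partial(2) by blast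
  then show ?case by simp
qed auto

definition diamond :: "'a::{finite,field} wordspace \<Rightarrow> 'a wordspace \<Rightarrow> 'a wordspace" where
  "diamond = bilinext diamond_word"

definition shuffle :: "'a::{finite,field} wordspace \<Rightarrow> 'a wordspace \<Rightarrow> 'a wordspace" where
  "shuffle = bilinext shuffle_word"

fun triangle_word :: "word \<Rightarrow> word \<Rightarrow> 'a::{finite,field} wordspace" where
  "triangle_word [] v = basis v"
| "triangle_word (a # u) [] = basis (a # u)"
| "triangle_word (a # u) (b # v) = prepend a (shuffle_word u (b # v))"

definition tensor :: "'a::field wordspace \<Rightarrow> 'a wordspace \<Rightarrow> 'a tensorspace" where
  "tensor = bilinext (\<lambda>u v. basis (u, v))"

definition tensor_shuffle ::
    "'a::{finite,field} tensorspace \<Rightarrow> 'a tensorspace \<Rightarrow> 'a tensorspace" where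
  "tensor_shuffle =
     bilinext (\<lambda>(u1, v1) (u2, v2). tensor (shuffle_word u1 u2) (shuffle_word v1 v2))"

text \<open>The bilinear operation sending \<open>(u1 \<otimes> v1, u2 \<otimes> v2)\<close> to the tensor product of the triangle
  product of \<open>u1, u2\<close> and the shuffle product of \<open>v1, v2\<close>.\<close>

definition tensor_triangle_shuffle ::
    "'a::{finite,field} tensorspace \<Rightarrow> 'a tensorspace \<Rightarrow> 'a tensorspace" where
  "tensor_triangle_shuffle =
     bilinext (\<lambda>(u1, v1) (u2, v2). tensor (triangle_word u1 u2) (shuffle_word v1 v2))"

text \<open>In the clause for depth greater than one, the sum of the \<open>a\<^sub>u \<otimes> b\<^sub>u\<close> is
  \<open>coproduct_word [u] - basis ([], [u])\<close>. The value on \<open>[0]\<close>, which is not a word over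
  \<open>\<Sigma>\<close>, is a dummy.\<close>

function coproduct_word :: "word \<Rightarrow> 'a::{finite,field} tensorspace" where
  "coproduct_word [] = basis ([], [])"
| "coproduct_word [w] =
     (if w = 0 then 0
      else if w = 1 then basis ([], [1]) + basis ([1], [])
      else tensor_shuffle (coproduct_word [1]) (coproduct_word [w - 1])
         - coproduct_word [1, w - 1] - coproduct_word [w - 1, 1]
         - (\<Sum>j \<in> {0<..<w}. smul (delta_coeff 1 (w - 1) j) (coproduct_word [w - j, j])))"
| "coproduct_word (u # v # vs) =
     basis ([], u # v # vs)
     + tensor_triangle_shuffle (coproduct_word [u] - basis ([], [u])) (coproduct_word (v # vs))"
  by pat_completeness auto
termination
  by (relation "measure (\<lambda>u. \<Sum>n \<leftarrow> u. max 1 (2 * n - 1))") (auto simp: max_def)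

definition coproduct :: "'a::{finite,field} wordspace \<Rightarrow> 'a tensorspace" where
  "coproduct = linext coproduct_word"

end

theory Submission
  imports Defs "HOL-Computational_Algebra.Formal_Laurent_Series"
begin

text \<open>
  Write \<open>T\<^sub>a\<close> for the terms of the coproduct of the letter \<open>a\<close> other than \<open>1 \<otimes> x\<^sub>a\<close>. All of them
  have a nonempty left factor, so the coproduct of \<open>x\<^sub>a p\<close> is \<open>1 \<otimes> x\<^sub>a p\<close> plus the triangle
  product of \<open>T\<^sub>a\<close> with the coproduct of \<open>p\<close>. Expanding both sides of the theorem for words
  beginning with \<open>a\<close> and \<open>b\<close> leaves, modulo smaller weight, one identity for the diamond product of
  \<open>T\<^sub>a\<close> and \<open>T\<^sub>b\<close>, which is equivalent to the theorem for the two letters. For letters, \<open>a = 1\<close>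
  is the recursive definition of the coproduct, and \<open>a > 1\<close> follows by writing \<open>x\<^sub>a\<close> as
  \<open>x\<^sub>1\<close> shuffled with \<open>x\<^sub>a\<^sub>-\<^sub>1\<close> minus words of depth two.

  This uses associativity of the shuffle product, which the same kind of expansion reduces to
  \<open>(x\<^sub>a \<diamondop> x\<^sub>b) \<diamondop> x\<^sub>c = (x\<^sub>b \<diamondop> x\<^sub>c) \<diamondop> x\<^sub>a\<close>. Send \<open>x\<^sub>i\<close> to the sum of \<open>(t + v)\<^sup>-\<^sup>i\<close> over a
  two-dimensional \<open>F\<^sub>q\<close>-space of \<open>v\<close>, and the later letters to similar sums over smaller spaces. By
  partial fractions, both sides are sent to the product of the images of the three letters.
  Coefficients of Laurent series separate the words of depth at most three and of given weight.
\<close>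

abbreviation keys where "keys \<equiv> Poly_Mapping.keys"
abbreviation lookup where "lookup \<equiv> Poly_Mapping.lookup"

section \<open>Linear maps between spaces with a basis\<close>

lemma lookup_smul [simp]: "lookup (smul c p) u = c * lookup p u"
  unfolding smul_def by (simp add: Poly_Mapping.map.rep_eq when_def)

lemma lookup_basis: "lookup (basis u) v = (if u = v then 1 else 0)"
  by (simp add: basis_def lookup_single when_def)

lemma smul_add: "smul c (p + r) = smul c p + smul c r"
  by (rule poly_mapping_eqI) (simp add: lookup_add algebra_simps)

lemma smul_diff: "smul c (p - r) = smul c p - smul c r"
  by (rule poly_mapping_eqI) (simp add: lookup_minus algebra_simps)

lemma add_smul: "smul (c + d) p = smul c p + smul d p"
  by (rule poly_mapping_eqI) (simp add: lookup_add algebra_simps)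

lemma smul_smul: "smul c (smul d p) = smul (c * d) p"
  by (rule poly_mapping_eqI) simp

lemma smul_commute: "smul c (smul d p) = smul d (smul c p)"
  by (simp add: smul_smul mult.commute)

lemma smul_zero [simp]: "smul c 0 = 0" "smul 0 p = 0"
  by (rule poly_mapping_eqI; simp)+

lemma smul_one [simp]: "smul 1 p = p"
  by (rule poly_mapping_eqI) simp

lemma smul_sum: "smul c (\<Sum>i\<in>I. f i) = (\<Sum>i\<in>I. smul c (f i))"
  by (induction I rule: infinite_finite_induct) (simp_all add: smul_add)

definition lin_map :: "(('x \<Rightarrow>\<^sub>0 'a::field) \<Rightarrow> ('y \<Rightarrow>\<^sub>0 'a)) \<Rightarrow> bool" where
  "lin_map F \<longleftrightarrow> (\<forall>p r. F (p + r) = F p + F r) \<and> (\<forall>c p. F (smul c p) = smul c (F p))"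

lemma lin_mapI:
  assumes "\<And>p r. F (p + r) = F p + F r" and "\<And>c p. F (smul c p) = smul c (F p)"
  shows "lin_map F"
  using assms by (simp add: lin_map_def)

lemma lin_map_add: "lin_map F \<Longrightarrow> F (p + r) = F p + F r"
  and lin_map_smul: "lin_map F \<Longrightarrow> F (smul c p) = smul c (F p)"
  by (simp_all add: lin_map_def)

lemma lin_map_zero: "lin_map F \<Longrightarrow> F 0 = 0"
  using lin_map_smul[of F 0 0] by simp

lemma lin_map_diff: "lin_map F \<Longrightarrow> F (p - r) = F p - F r"
  using lin_map_add[of F "p - r" r] by (simp add: algebra_simps)

lemma lin_map_sum: "lin_map F \<Longrightarrow> F (\<Sum>i\<in>I. f i) = (\<Sum>i\<in>I. F (f i))"
  by (induction I rule: infinite_finite_induct) (simp_all add: lin_map_zero lin_map_add)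

text \<open>Terms outside the support have coefficient zero. A common index set is what allows sums
  over different supports to be added.\<close>

lemma linext_superset:
  assumes "finite A" "keys p \<subseteq> A"
  shows "linext f p = (\<Sum>u\<in>A. smul (lookup p u) (f u))"
  unfolding linext_def using assms
  by (intro sum.mono_neutral_left) (auto simp: in_keys_iff)

lemma lin_map_linext:
  fixes f :: "'x \<Rightarrow> ('y \<Rightarrow>\<^sub>0 'a::field)"
  shows "lin_map (linext f)"
proof (rule lin_mapI)
  fix p r :: "'x \<Rightarrow>\<^sub>0 'a"
  let ?A = "keys p \<union> keys r"
  have "linext f (p + r) = (\<Sum>u\<in>?A. smul (lookup (p + r) u) (f u))"
    by (rule linext_superset) (auto dest: subsetD[OF Poly_Mapping.keys_add])
  also have "\<dots> = (\<Sum>u\<in>?A. smul (lookup p u) (f u)) + (\<Sum>u\<in>?A. smul (lookup r u) (f u))"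
    by (simp add: lookup_add add_smul sum.distrib)
  also have "\<dots> = linext f p + linext f r"
    by (subst (1 2) linext_superset[where A = ?A]) auto
  finally show "linext f (p + r) = linext f p + linext f r" .
next
  fix c and p :: "'x \<Rightarrow>\<^sub>0 'a"
  have "linext f (smul c p) = (\<Sum>u\<in>keys p. smul (lookup (smul c p) u) (f u))"
    by (rule linext_superset) (auto dest: subsetD[OF keys_smul])
  then show "linext f (smul c p) = smul c (linext f p)"
    by (simp add: linext_def smul_sum smul_smul)
qed

lemma linext_basis [simp]: "linext f (basis u) = f u"
  by (simp add: linext_def keys_basis lookup_basis)

lemma linext_basis_id [simp]: "linext basis p = p"
proof (rule poly_mapping_eqI)
  fix v
  have "lookup (linext basis p) v = (\<Sum>u\<in>keys p. if u = v then lookup p u else 0)"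
    unfolding linext_def lookup_sum
    by (intro sum.cong) (simp_all add: lookup_basis)
  also have "\<dots> = lookup p v"
    by (simp add: sum.delta in_keys_iff)
  finally show "lookup (linext basis p) v = lookup p v" .
qed

text \<open>Agreement is asked only on the support of \<open>p\<close>, since many identities below
  hold just for words with positive letters.\<close>

lemma lin_map_eqI:
  assumes F: "lin_map F" and G: "lin_map G"
    and eq: "\<And>u. u \<in> keys p \<Longrightarrow> F (basis u) = G (basis u)"
  shows "F p = G p"
proof -
  have "F (linext basis p) = G (linext basis p)"
    unfolding linext_def lin_map_sum[OF F] lin_map_sum[OF G] lin_map_smul[OF F] lin_map_smul[OF G]
    using eq by (intro sum.cong) simp_all
  then show ?thesis by simp
qed

lemma lin_map_id: "lin_map (\<lambda>p. p)"
  by (simp add: lin_map_def)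

lemma lin_map_comp: "lin_map F \<Longrightarrow> lin_map G \<Longrightarrow> lin_map (\<lambda>p. G (F p))"
  by (simp add: lin_map_def)

lemma lin_map_plus: "lin_map F \<Longrightarrow> lin_map G \<Longrightarrow> lin_map (\<lambda>p. F p + G p)"
  by (simp add: lin_map_def smul_add)

lemma lin_map_minus: "lin_map F \<Longrightarrow> lin_map G \<Longrightarrow> lin_map (\<lambda>p. F p - G p)"
  by (simp add: lin_map_def smul_diff)

lemma lin_map_smult: "lin_map F \<Longrightarrow> lin_map (\<lambda>p. smul c (F p))"
  by (simp add: lin_map_def smul_add smul_commute)

lemma lin_map_Sum: "(\<And>i. i \<in> I \<Longrightarrow> lin_map (F i)) \<Longrightarrow> lin_map (\<lambda>p. \<Sum>i\<in>I. F i p)"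
  by (simp add: lin_map_def sum.distrib smul_sum)

lemma lin_map_bilinext_left: "lin_map (\<lambda>p. bilinext f p r)"
  unfolding bilinext_def by (rule lin_map_linext)

lemma lin_map_bilinext_right: "lin_map (bilinext f p)"
proof -
  have "lin_map (\<lambda>r. \<Sum>u\<in>keys p. smul (lookup p u) (linext (f u) r))"
    by (intro lin_map_Sum lin_map_smult lin_map_linext)
  moreover have "bilinext f p = (\<lambda>r. \<Sum>u\<in>keys p. smul (lookup p u) (linext (f u) r))"
    by (rule ext) (simp only: bilinext_def linext_def[of "\<lambda>u. linext (f u) _"])
  ultimately show ?thesis by (simp only:)
qed

lemma bilinext_basis [simp]: "bilinext f (basis u) (basis v) = f u v"
  by (simp add: bilinext_def)

lemma bilinext_eqI:
  assumes F: "\<And>r. lin_map (\<lambda>p. F p r)" "\<And>p. lin_map (\<lambda>r. F p r)"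
    and G: "\<And>r. lin_map (\<lambda>p. G p r)" "\<And>p. lin_map (\<lambda>r. G p r)"
    and eq: "\<And>u v. u \<in> keys p \<Longrightarrow> v \<in> keys r \<Longrightarrow> F (basis u) (basis v) = G (basis u) (basis v)"
  shows "F p r = G p r"
proof -
  have "F (basis u) r = G (basis u) r" if "u \<in> keys p" for u
    by (rule lin_map_eqI[where F = "F (basis u)" and G = "G (basis u)"]) (use F G eq that in auto)
  then show ?thesis
    by (rule lin_map_eqI[where F = "\<lambda>p. F p r" and G = "\<lambda>p. G p r", OF F(1) G(1)])
qed

lemma keys_bilinext:
  assumes "\<And>u v. u \<in> keys p \<Longrightarrow> v \<in> keys r \<Longrightarrow> keys (f u v) \<subseteq> A"
  shows "keys (bilinext f p r) \<subseteq> A"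
proof -
  have "keys (linext (f u) r) \<subseteq> A" if "u \<in> keys p" for u
    using keys_linext[of "f u" r] assms[OF that] by blast
  then show ?thesis
    unfolding bilinext_def using keys_linext[of "\<lambda>u. linext (f u) r" p] by blast
qed

lemma keys_plus_subset:
  fixes p r :: "'x \<Rightarrow>\<^sub>0 'a::field"
  shows "keys p \<subseteq> A \<Longrightarrow> keys r \<subseteq> A \<Longrightarrow> keys (p + r) \<subseteq> A"
  using Poly_Mapping.keys_add[of p r] by blast

lemma keys_minus_subset:
  fixes p r :: "'x \<Rightarrow>\<^sub>0 'a::field"
  shows "keys p \<subseteq> A \<Longrightarrow> keys r \<subseteq> A \<Longrightarrow> keys (p - r) \<subseteq> A"
  using keys_diff[of p r] by blast

lemma keys_smul_subset: "keys p \<subseteq> A \<Longrightarrow> keys (smul c p) \<subseteq> A"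
  using keys_smul[of c p] by blast

lemma keys_sum_subset: "(\<And>i. i \<in> I \<Longrightarrow> keys (f i) \<subseteq> A) \<Longrightarrow> keys (\<Sum>i\<in>I. f i) \<subseteq> A"
  by (rule order.trans[OF keys_sum]) (rule UN_least)

lemmas keys_subset_intros = keys_plus_subset keys_minus_subset keys_smul_subset keys_sum_subset

section \<open>The shuffle product\<close>

lemma lin_map_prepend: "lin_map (prepend n)"
  unfolding prepend_def by (rule lin_map_linext)

lemma lin_map_shuffle_left: "lin_map (\<lambda>p. shuffle p r)"
  unfolding shuffle_def by (rule lin_map_bilinext_left)

lemma lin_map_shuffle_right: "lin_map (shuffle p)"
  unfolding shuffle_def by (rule lin_map_bilinext_right)

lemma prepend_basis [simp]: "prepend n (basis u) = basis (n # u)"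
  by (simp add: prepend_def)

lemma shuffle_basis: "shuffle (basis u) (basis v) = shuffle_word u v"
  by (simp add: shuffle_def)

lemmas prepend_lin = lin_map_add[OF lin_map_prepend] lin_map_diff[OF lin_map_prepend]
  lin_map_smul[OF lin_map_prepend] lin_map_sum[OF lin_map_prepend] lin_map_zero[OF lin_map_prepend]

lemmas shuffle_left = lin_map_add[OF lin_map_shuffle_left] lin_map_diff[OF lin_map_shuffle_left]
  lin_map_smul[OF lin_map_shuffle_left] lin_map_sum[OF lin_map_shuffle_left]
  lin_map_zero[OF lin_map_shuffle_left]

abbreviation letter :: "nat \<Rightarrow> 'a::field wordspace" where
  "letter n \<equiv> basis [n]"

text \<open>The diamond product of two nonempty words depends only on their first letters and on the
  shuffle product \<open>p\<close> of their tails.\<close>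

definition merge :: "nat \<Rightarrow> nat \<Rightarrow> 'a::{finite,field} wordspace \<Rightarrow> 'a wordspace" where
  "merge a b p = prepend (a + b) p
     + (\<Sum>j\<in>{1..<a + b}. smul (delta_coeff a b j) (prepend (a + b - j) (shuffle (letter j) p)))"

lemma lin_map_merge: "lin_map (merge a b)"
  unfolding merge_def[abs_def]
  by (intro lin_map_plus lin_map_Sum lin_map_smult lin_map_prepend
      lin_map_comp[OF lin_map_shuffle_right lin_map_prepend])

lemmas lin_map_intros = lin_map_id lin_map_plus lin_map_minus lin_map_smult lin_map_Sum
  lin_map_comp[OF _ lin_map_prepend] lin_map_comp[OF _ lin_map_merge]
  lin_map_comp[OF _ lin_map_shuffle_left] lin_map_comp[OF _ lin_map_shuffle_right]

lemma delta_coeff_commute: "delta_coeff a b j = delta_coeff b a j"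
  by (simp add: delta_coeff_def add.commute)

lemma merge_commute: "merge a b p = merge b a p"
  unfolding merge_def by (simp add: add.commute[of a b] delta_coeff_commute[of a b])

lemma shuffle_letter_linext: "shuffle (letter j) p = linext (shuffle_word [j]) p"
  by (simp add: shuffle_def bilinext_def)

lemma diamond_word_Cons: "diamond_word (a # u) (b # v) = merge a b (shuffle_word u v)"
  by (simp add: merge_def shuffle_letter_linext)

lemma shuffle_word_Cons:
  "shuffle_word (a # u) (b # v) = prepend a (shuffle_word u (b # v))
     + prepend b (shuffle_word (a # u) v) + merge a b (shuffle_word u v)"
  by (simp add: merge_def shuffle_letter_linext)

lemma shuffle_word_Nil [simp]: "shuffle_word [] v = basis v" "shuffle_word u [] = basis u"
  by (cases u; simp)+

lemma shuffle_Nil [simp]: "shuffle (basis []) p = p" "shuffle p (basis []) = p"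
proof -
  have "shuffle_word [] = (basis :: _ \<Rightarrow> 'a wordspace)" by (rule ext) simp
  then show "shuffle (basis []) p = p" by (simp add: shuffle_def bilinext_def)
qed (simp add: shuffle_def bilinext_def)

text \<open>The recursion extends from words to arbitrary tails because \<open>merge\<close> sees
  the tails only through their product.\<close>

lemma shuffle_prepend:
  "shuffle (prepend a p) (prepend b r) = prepend a (shuffle p (prepend b r))
     + prepend b (shuffle (prepend a p) r) + merge a b (shuffle p r)"
proof (rule bilinext_eqI[where F = "\<lambda>p r. shuffle (prepend a p) (prepend b r)" and
      G = "\<lambda>p r. prepend a (shuffle p (prepend b r)) + prepend b (shuffle (prepend a p) r)
        + merge a b (shuffle p r)"])
  fix u v :: word
  show "shuffle (prepend a (basis u)) (prepend b (basis v)) =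
     prepend a (shuffle (basis u) (prepend b (basis v)))
       + prepend b (shuffle (prepend a (basis u)) (basis v)) + merge a b (shuffle (basis u) (basis v))"
    by (simp only: prepend_basis shuffle_basis shuffle_word_Cons)
qed (intro lin_map_intros)+

text \<open>Swapping the arguments exchanges the first two terms of the recursion, and
  \<open>merge\<close> is symmetric in its two letters.\<close>

lemma shuffle_word_commute: "(shuffle_word u v :: 'a::{finite,field} wordspace) = shuffle_word v u"
proof (induction "length u + length v" arbitrary: u v rule: less_induct)
  case less
  show ?case
  proof (cases "u = [] \<or> v = []")
    case False
    then obtain a u' b v' where uv: "u = a # u'" "v = b # v'"
      by (meson neq_Nil_conv)
    have "(shuffle_word u' v :: 'a wordspace) = shuffle_word v u'"
        "(shuffle_word u v' :: 'a wordspace) = shuffle_word v' u"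
        "(shuffle_word u' v' :: 'a wordspace) = shuffle_word v' u'"
      by (rule less.hyps; simp add: uv)+
    then show ?thesis
      unfolding uv shuffle_word_Cons by (simp add: merge_commute[of a b] add.commute)
  qed auto
qed

lemma shuffle_commute: "shuffle p r = shuffle r p"
  by (rule bilinext_eqI[where F = "\<lambda>p r. shuffle p r" and G = "\<lambda>p r. shuffle r p"])
    (simp_all add: lin_map_shuffle_left lin_map_shuffle_right shuffle_basis shuffle_word_commute)

section \<open>Weight and depth of the words in a product\<close>

definition words_of :: "nat \<Rightarrow> nat \<Rightarrow> word set" where
  "words_of n l = {w \<in> words. sum_list w = n \<and> length w \<le> l}"

lemma Nil_in_words [simp]: "[] \<in> words"
  and Cons_in_words [simp]: "a # u \<in> words \<longleftrightarrow> 1 \<le> a \<and> u \<in> words"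
  by (auto simp: words_def)

lemma keys_prepend_words_of:
  assumes "keys p \<subseteq> words_of n l" "1 \<le> a"
  shows "keys (prepend a p) \<subseteq> words_of (a + n) (Suc l)"
  using keys_prepend[of a p] assms by (fastforce simp: words_of_def)

text \<open>Every term of the recursion keeps the weight, whereas depth is only bounded above, since
  two letters may contract into one.\<close>

lemma keys_shuffle_word:
  fixes u v :: word
  shows "u \<in> words \<Longrightarrow> v \<in> words \<Longrightarrow> keys (diamond_word u v :: 'a::{finite,field} wordspace)
      \<subseteq> words_of (sum_list u + sum_list v) (length u + length v)"
    and "u \<in> words \<Longrightarrow> v \<in> words \<Longrightarrow> keys (shuffle_word u v :: 'a wordspace)
      \<subseteq> words_of (sum_list u + sum_list v) (length u + length v)"
proof (induction u v and u v rule: diamond_word_shuffle_word.induct[where 'a = 'a])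
  case (3 a u b v)
  let ?n = "sum_list u + sum_list v" and ?l = "length u + length v"
  have s: "keys (shuffle_word u v :: 'a wordspace) \<subseteq> words_of ?n ?l"
    using 3 by simp
  have mono: "words_of n l \<subseteq> words_of n' l'" if "n = n'" "l \<le> l'" for n l n' l'
    using that by (auto simp: words_of_def)
  have "keys (prepend (a + b) (shuffle_word u v) :: 'a wordspace)
      \<subseteq> words_of (a + b + ?n) (Suc (Suc ?l))"
    by (rule order.trans[OF keys_prepend_words_of[OF s] mono]) (use 3 in auto)
  moreover have "keys (prepend (a + b - j) (linext (shuffle_word [j]) (shuffle_word u v)) :: 'a wordspace)
      \<subseteq> words_of (a + b + ?n) (Suc (Suc ?l))" if j: "j \<in> {1..<a + b}" for j
  proof -
    \<comment> \<open>This is the nested recursive call: \<open>c\<close> runs over the support of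
      the inner product, so its weight and depth must be known first.\<close>
    have "keys (shuffle_word [j] c :: 'a wordspace) \<subseteq> words_of (j + ?n) (Suc ?l)"
      if c: "c \<in> keys (shuffle_word u v :: 'a wordspace)" for c
    proof -
      have "c \<in> words_of ?n ?l" using s c by blast
      moreover from this have "keys (shuffle_word [j] c :: 'a wordspace)
          \<subseteq> words_of (sum_list [j] + sum_list c) (length [j] + length c)"
        using j by (intro 3(3)[OF j c]) (auto simp: words_of_def)
      ultimately show ?thesis
        by (auto simp: words_of_def)
    qed
    then have "keys (linext (shuffle_word [j]) (shuffle_word u v) :: 'a wordspace)
        \<subseteq> words_of (j + ?n) (Suc ?l)"
      using keys_linext[of "shuffle_word [j] :: _ \<Rightarrow> 'a wordspace" "shuffle_word u v"] by blast
    then show ?thesis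
      by (rule order.trans[OF keys_prepend_words_of mono]) (use j in auto)
  qed
  ultimately have "keys (diamond_word (a # u) (b # v) :: 'a wordspace)
      \<subseteq> words_of (a + b + ?n) (Suc (Suc ?l))"
    unfolding diamond_word.simps by (intro keys_subset_intros)
  then show ?case by (simp add: add_ac)
next
  case (6 a u b v)
  have "keys (prepend a (shuffle_word u (b # v)) :: 'a wordspace)
     \<subseteq> words_of (a + (sum_list u + sum_list (b # v))) (Suc (length u + length (b # v)))"
    "keys (prepend b (shuffle_word (a # u) v) :: 'a wordspace)
     \<subseteq> words_of (b + (sum_list (a # u) + sum_list v)) (Suc (length (a # u) + length v))"
    using 6 by (intro keys_prepend_words_of; simp)+
  moreover have "keys (diamond_word (a # u) (b # v) :: 'a wordspace)
     \<subseteq> words_of (sum_list (a # u) + sum_list (b # v)) (length (a # u) + length (b # v))"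
    using 6 by simp
  ultimately show ?case
    unfolding shuffle_word.simps by (intro keys_subset_intros) (simp_all add: add_ac)
qed (auto simp: keys_basis words_of_def)

definition homog :: "nat \<Rightarrow> 'a::{finite,field} wordspace \<Rightarrow> bool" where
  "homog n p \<longleftrightarrow> keys p \<subseteq> {w \<in> words. sum_list w = n}"

lemma homog_basis: "u \<in> words \<Longrightarrow> homog (sum_list u) (basis u)"
  by (simp add: homog_def keys_basis)

lemma homog_letter: "1 \<le> a \<Longrightarrow> homog a (letter a)"
  using homog_basis[of "[a]"] by simp

lemma homog_prepend: "homog n p \<Longrightarrow> 1 \<le> a \<Longrightarrow> homog (a + n) (prepend a p)"
  using keys_prepend[of a p] by (fastforce simp: homog_def)

lemma homog_shuffle_word: "u \<in> words \<Longrightarrow> v \<in> words \<Longrightarrow> homog (sum_list u + sum_list v) (shuffle_word u v)"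
  using keys_shuffle_word(2)[of u v] by (auto simp: homog_def words_of_def)

lemma homog_shuffle:
  fixes p r :: "'a::{finite,field} wordspace"
  assumes "homog m p" "homog n r"
  shows "homog (m + n) (shuffle p r)"
  unfolding homog_def shuffle_def
proof (rule keys_bilinext)
  fix u v assume "u \<in> keys p" "v \<in> keys r"
  then have "u \<in> words" "v \<in> words" "sum_list u = m" "sum_list v = n"
    using assms by (auto simp: homog_def)
  then show "keys (shuffle_word u v :: 'a wordspace) \<subseteq> {w \<in> words. sum_list w = m + n}"
    using homog_shuffle_word[of u v] by (simp add: homog_def)
qed

section \<open>Partial fractions\<close>

text \<open>Pascal's rule, after splitting off the term \<open>k = 0\<close>. Up to sign,
  \<open>G\<close> with \<open>s = -1\<close> and with \<open>s = 1\<close> gives the two halves of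
  a partial fraction expansion.\<close>

lemma partial_fraction_recursion:
  fixes s u w :: "'k::comm_ring_1"
  defines "G \<equiv> \<lambda>a b. \<Sum>k<a. s ^ k * of_nat ((b + k - 1) choose k) * u ^ (a - k) * w ^ (b + k)"
  shows "G (Suc a) (Suc b) = w * (G (Suc a) b + s * G a (Suc b))"
proof -
  have G1: "G (Suc a) m = u ^ Suc a * w ^ m + (\<Sum>k<a. s ^ Suc k * of_nat ((m + k) choose Suc k)
      * u ^ (a - k) * w ^ (m + Suc k))" for m
    unfolding G_def by (subst sum.lessThan_Suc_shift) simp
  have "G (Suc a) (Suc b) = u ^ Suc a * w ^ Suc b + (\<Sum>k<a. w * (s ^ Suc k * of_nat ((b + k) choose Suc k)
      * u ^ (a - k) * w ^ (b + Suc k)) + w * (s * (s ^ k * of_nat ((Suc b + k - 1) choose k) * u ^ (a - k) * w ^ (Suc b + k))))"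
    unfolding G1 by (intro arg_cong2[where f = plus] refl sum.cong) (simp_all add: algebra_simps)
  then show ?thesis
    unfolding G1[of b] unfolding G_def by (simp add: sum.distrib sum_distrib_left algebra_simps)
qed

text \<open>The model is \<open>u = 1/c\<close>, \<open>v = 1/(c + d)\<close>,
  \<open>w = 1/d\<close>. For positive exponents the hypothesis gives \<open>u ^ a * v ^ b = w * (u
  ^ a * v ^ (b - 1) - u ^ (a - 1) * v ^ b)\<close>, and both halves on the right obey the same
  recursion.\<close>

lemma partial_fraction_sums:
  fixes u v w :: "'k::comm_ring_1"
  assumes "u * v = w * (u - v)" and "0 < a + b"
  shows "u ^ a * v ^ b
    = (\<Sum>k<a. (-1) ^ k * of_nat ((b + k - 1) choose k) * u ^ (a - k) * w ^ (b + k))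
      + (-1) ^ a * (\<Sum>k<b. 1 ^ k * of_nat ((a + k - 1) choose k) * v ^ (b - k) * w ^ (a + k))"
    (is "_ = ?A a b + (-1) ^ a * ?B b a")
  using assms(2)
proof (induction "a + b" arbitrary: a b)
  case (Suc n)
  \<comment> \<open>When one exponent is 0, only \<open>k = 0\<close> survives: truncated
    subtraction makes its binomial \<open>0 choose 0\<close>, and \<open>(k - 1) choose k\<close> is
    0 for \<open>k > 0\<close>.\<close>
  have triv: "(\<Sum>k<Suc m. s ^ k * of_nat ((0 + k - 1) choose k) * x ^ (Suc m - k) * w ^ (0 + k)) = x ^ Suc m"
    for m and s x :: 'k
    by (subst sum.lessThan_Suc_shift) (simp add: binomial_eq_0)
  show ?case
  proof (cases a)
    case 0
    then obtain m where "b = Suc m" using Suc by (cases b) auto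
    then show ?thesis using 0 triv[where s = 1] by simp
  next
    case a: (Suc a')
    show ?thesis
    proof (cases b)
      case 0
      then show ?thesis using a triv[where s = "-1"] by simp
    next
      case b: (Suc b')
      have "u ^ a * v ^ b' = ?A a b' + (-1) ^ a * ?B b' a"
        using Suc a b by (intro Suc.hyps) auto
      moreover have "u ^ a' * v ^ b = ?A a' b + (-1) ^ a' * ?B b a'"
        using Suc a b by (intro Suc.hyps) auto
      moreover have "u ^ a * v ^ b = u ^ a' * v ^ b' * (u * v)"
        by (simp add: a b algebra_simps)
      then have "u ^ a * v ^ b = w * (u ^ a * v ^ b' - u ^ a' * v ^ b)"
        unfolding assms(1) by (simp add: a b algebra_simps)
      ultimately have "u ^ a * v ^ b
          = w * ((?A a b' + (-1) ^ a * ?B b' a) - (?A a' b + (-1) ^ a' * ?B b a'))"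
        by simp
      also have "\<dots> = w * (?A a b' + (-1) * ?A a' b) + (-1) ^ a * (w * (?B b a' + 1 * ?B b' a))"
        by (simp add: a algebra_simps)
      also have "w * (?A a b' + (-1) * ?A a' b) = ?A a b"
        unfolding a b by (rule partial_fraction_recursion[symmetric])
      also have "w * (?B b a' + 1 * ?B b' a) = ?B b a"
        unfolding a b by (rule partial_fraction_recursion[symmetric])
      finally show ?thesis .
    qed
  qed
qed simp

text \<open>The two sums are reindexed by the exponent \<open>j\<close> of \<open>w\<close>. The
  binomials vanish for the small \<open>j\<close> added in this way, so both halves run over the
  index range of the diamond product.\<close>

lemma partial_fractions:
  fixes u v w :: "'k::comm_ring_1"
  assumes "u * v = w * (u - v)" and ab: "1 \<le> a" "1 \<le> b"
  shows "u ^ a * v ^ b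
    = (\<Sum>j\<in>{1..<a + b}. ((-1) ^ (j + b) * of_nat ((j - 1) choose (b - 1)) * u ^ (a + b - j)
        + (-1) ^ a * of_nat ((j - 1) choose (a - 1)) * v ^ (a + b - j)) * w ^ j)"
proof -
  have shift: "(\<Sum>k<m. s ^ k * of_nat ((n + k - 1) choose k) * x ^ (m - k) * w ^ (n + k))
      = (\<Sum>j\<in>{1..<m + n}. s ^ (j + n) * of_nat ((j - 1) choose (n - 1)) * x ^ (m + n - j) * w ^ j)"
    if "1 \<le> n" "s = 1 \<or> s = -1" for m n and s x :: 'k
  proof -
    have "s * s = 1" using that(2) by auto
    then have s: "s ^ (n + (k + n)) = s ^ k" for k
      by (simp add: power_add mult.left_commute flip: power_mult_distrib)
    have "(\<Sum>k<m. s ^ k * of_nat ((n + k - 1) choose k) * x ^ (m - k) * w ^ (n + k))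
      = (\<Sum>j\<in>{n..<m + n}. s ^ (j + n) * of_nat ((j - 1) choose (n - 1)) * x ^ (m + n - j) * w ^ j)"
    proof (rule sum.reindex_bij_witness[where i = "\<lambda>j. j - n" and j = "\<lambda>k. k + n"], goal_cases)
      case (5 k)
      have "(n + k - 1) choose k = (k + n - 1) choose (n - 1)"
        using that(1) by (subst binomial_symmetric) (auto simp: add.commute)
      then show ?case by (simp add: s add.commute)
    qed auto
    also have "\<dots> = (\<Sum>j\<in>{1..<m + n}. s ^ (j + n) * of_nat ((j - 1) choose (n - 1)) * x ^ (m + n - j) * w ^ j)"
      using that(1) by (intro sum.mono_neutral_left) (auto simp: binomial_eq_0)
    finally show ?thesis .
  qed
  have "u ^ a * v ^ b = (\<Sum>j\<in>{1..<a + b}. (-1) ^ (j + b) * of_nat ((j - 1) choose (b - 1)) * u ^ (a + b - j) * w ^ j)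
      + (-1) ^ a * (\<Sum>j\<in>{1..<b + a}. 1 ^ (j + a) * of_nat ((j - 1) choose (a - 1)) * v ^ (b + a - j) * w ^ j)"
    using ab partial_fraction_sums[OF assms(1), of a b]
    unfolding shift[OF ab(2) disjI2[OF refl]] shift[OF ab(1) disjI1[OF refl]] by simp
  then show ?thesis
    by (simp add: sum_distrib_left sum.distrib add.commute[of b a] algebra_simps)
qed

section \<open>Power sums over a finite field\<close>

lemma finite_field_power_card:
  fixes x :: "'a::{finite,field}"
  assumes "x \<noteq> 0"
  shows "x ^ (CARD('a) - 1) = 1"
proof -
  let ?U = "UNIV - {0 :: 'a}"
  have "(\<Prod>y\<in>?U. x * y) = (\<Prod>y\<in>?U. y)"
    by (rule prod.reindex_bij_witness[where i = "\<lambda>y. y / x" and j = "\<lambda>y. x * y"]) (use assms in auto)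
  moreover have "(\<Prod>y\<in>?U. y) \<noteq> 0" by simp
  ultimately show ?thesis by (simp add: prod.distrib card_Diff_singleton)
qed

text \<open>This is the source of the divisibility condition in \<open>delta_coeff\<close>. If
  \<open>CARD('a) - 1\<close> does not divide \<open>j\<close>, some nonzero \<open>y\<close> has
  \<open>y ^ j \<noteq> 1\<close>; rescaling by \<open>y\<close> multiplies the sum by
  \<open>y ^ j\<close>, so it is 0.\<close>

lemma sum_inverse_power_finite_field:
  "(\<Sum>x\<in>UNIV - {0 :: 'a::{finite,field}}. inverse x ^ j) = (if (CARD('a) - 1) dvd j then -1 else 0)"
proof -
  let ?U = "UNIV - {0 :: 'a}" and ?Q = "CARD('a) - 1"
  have card: "2 \<le> CARD('a)"
    using card_mono[of UNIV "{0, 1 :: 'a}"] by simp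
  show ?thesis
  proof (cases "?Q dvd j")
    case True
    then have "inverse x ^ j = 1" if "x \<in> ?U" for x
      using finite_field_power_card[of "inverse x"] that by (auto simp: power_mult elim!: dvdE)
    then have "(\<Sum>x\<in>?U. inverse x ^ j) = of_nat ?Q"
      by (simp add: card_Diff_singleton)
    also have "\<dots> = of_nat CARD('a) - (1 :: 'a)"
      using card by (subst of_nat_diff) auto
    also have "of_nat CARD('a) = (0 :: 'a)"
    proof -
      have "(\<Sum>y\<in>UNIV. 1 + y) = (\<Sum>y\<in>(UNIV :: 'a set). y)"
        by (rule sum.reindex_bij_witness[where i = "\<lambda>y. y - 1" and j = "\<lambda>y. 1 + y"]) auto
      then show ?thesis by (simp add: sum.distrib)
    qed
    finally show ?thesis using True by simp
  next
    case False
    define r where "r = j mod ?Q"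
    have r: "0 < r" "r < ?Q"
      using False card by (simp_all add: r_def dvd_eq_mod_eq_0)
    \<comment> \<open>Otherwise all \<open>CARD('a) - 1\<close> nonzero elements would be roots of a
      nonzero polynomial of degree at most \<open>r\<close>, which is smaller.\<close>
    have "\<exists>y\<in>?U. y ^ r \<noteq> 1"
    proof (rule ccontr)
      assume "\<not> ?thesis"
      then have sub: "?U \<subseteq> {x. poly (monom 1 r - 1) x = 0}"
        by (auto simp: poly_monom)
      have deg: "degree (monom 1 r - 1 :: 'a poly) \<le> r"
        by (intro degree_diff_le) (auto simp: degree_monom_eq)
      have "coeff (monom 1 r - 1 :: 'a poly) r \<noteq> 0"
        using r by simp
      then have nz: "monom 1 r - 1 \<noteq> (0 :: 'a poly)"
        by (metis coeff_0)
      have "?Q \<le> card {x :: 'a. poly (monom 1 r - 1) x = 0}"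
        using card_mono[OF _ sub] by (simp add: card_Diff_singleton)
      also have "\<dots> \<le> r"
        using card_poly_roots_bound[OF nz] deg by linarith
      finally show False using r by simp
    qed
    then obtain y :: 'a where y: "y \<noteq> 0" "y ^ r \<noteq> 1" by blast
    have "y ^ j = (y ^ ?Q) ^ (j div ?Q) * y ^ r"
      by (simp add: r_def flip: power_mult power_add)
    then have yj: "y ^ j \<noteq> 1"
      using y finite_field_power_card[of y] by simp
    have "(\<Sum>x\<in>?U. inverse (x / y) ^ j) = (\<Sum>x\<in>?U. inverse x ^ j)"
      by (rule sum.reindex_bij_witness[where i = "\<lambda>x. x * y" and j = "\<lambda>x. x / y"]) (use y in auto)
    moreover have "(\<Sum>x\<in>?U. inverse (x / y) ^ j) = y ^ j * (\<Sum>x\<in>?U. inverse x ^ j)"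
      unfolding sum_distrib_left by (intro sum.cong) (simp_all add: power_mult_distrib field_simps)
    ultimately have "(y ^ j - 1) * (\<Sum>x\<in>?U. inverse x ^ j) = 0"
      by (simp add: algebra_simps)
    then show ?thesis using yj False by simp
  qed
qed

unbundle fps_syntax

section \<open>Sums of simple poles over a finite additive group\<close>

text \<open>The scalars are used inside themselves, inside Laurent series and inside iterated
  Laurent series, so the embedding is a parameter.\<close>

definition field_hom :: "('a::field \<Rightarrow> 'k::field) \<Rightarrow> bool" where
  "field_hom e \<longleftrightarrow> e 1 = 1 \<and> (\<forall>x y. e (x + y) = e x + e y) \<and> (\<forall>x y. e (x * y) = e x * e y)"

lemma field_homD:
  assumes "field_hom e"
  shows "e 1 = 1" "e (x + y) = e x + e y" "e (x * y) = e x * e y"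
  using assms by (simp_all add: field_hom_def)

lemma field_hom_zero: "field_hom e \<Longrightarrow> e 0 = 0"
  using field_homD(2)[of e 0 0] by (metis add_cancel_left_right add_0)

lemma field_hom_minus: "field_hom e \<Longrightarrow> e (- x) = - e x"
  using field_homD(2)[of e x "- x"] field_hom_zero[of e] by (simp add: eq_neg_iff_add_eq_0 add.commute)

lemma field_hom_power: "field_hom e \<Longrightarrow> e (x ^ n) = e x ^ n"
  by (induction n) (simp_all add: field_homD[of e])

lemma field_hom_of_nat: "field_hom e \<Longrightarrow> e (of_nat n) = of_nat n"
  by (induction n) (simp_all add: field_homD[of e] field_hom_zero[of e])

lemma field_hom_sum: "field_hom e \<Longrightarrow> e (sum f A) = (\<Sum>x\<in>A. e (f x))"
  by (induction A rule: infinite_finite_induct) (simp_all add: field_homD[of e] field_hom_zero[of e])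

lemma field_hom_inverse:
  assumes "field_hom e"
  shows "e (inverse x) = inverse (e x)"
proof (cases "x = 0")
  case False
  then have "e x * e (inverse x) = 1"
    using field_homD(1,3)[OF assms] by (metis right_inverse)
  then show ?thesis by (metis inverse_unique)
qed (simp add: field_hom_zero[OF assms])

lemmas field_hom_simps = field_homD field_hom_zero field_hom_minus field_hom_power
  field_hom_of_nat field_hom_sum field_hom_inverse

lemma field_hom_fls_const: "field_hom fls_const"
  by (simp add: field_hom_def fls_plus_const fls_const_mult_const)

lemma field_hom_id: "field_hom (\<lambda>x. x)"
  by (simp add: field_hom_def)

definition pole_sum :: "'k::field set \<Rightarrow> nat \<Rightarrow> 'k fls" where
  "pole_sum U i = (\<Sum>c\<in>U. inverse (fls_X + fls_const c) ^ i)"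

lemma fls_X_plus_const_nonzero [simp]: "fls_X + fls_const c \<noteq> (0 :: 'k::field fls)"
proof
  assume "fls_X + fls_const c = 0"
  from arg_cong[OF this, of "\<lambda>f. f $$ 1"] show False by simp
qed

text \<open>In the expansion at \<open>X = 0\<close> the terms with \<open>c \<noteq> 0\<close> are
  power series, so the principal part is the power of \<open>1/X\<close> coming from
  \<open>c = 0\<close>.\<close>

lemma pole_sum_nth:
  assumes "finite U" "0 \<in> U" "1 \<le> i" "1 \<le> n"
  shows "pole_sum U i $$ (- int n) = (if i = n then 1 else (0 :: 'k::field))"
proof -
  have "(inverse (fls_X + fls_const c) ^ i) $$ (- int n) = (0 :: 'k)" if "c \<noteq> 0" for c
  proof -
    have "fls_subdegree (fls_X + fls_const c) = 0"
      using that by (intro fls_subdegree_eqI) auto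
    then have "fls_subdegree (inverse (fls_X + fls_const c) ^ i) = 0"
      by (simp add: fls_subdegree_pow fls_inverse_subdegree)
    then show ?thesis using assms(4) by (intro fls_eq0_below_subdegree) simp
  qed
  then have "pole_sum U i $$ (- int n) = (\<Sum>c\<in>U. if c = 0 then (inverse fls_X ^ i) $$ (- int n) else 0)"
    unfolding pole_sum_def fls_nth_sum by (intro sum.cong) auto
  also have "\<dots> = (inverse fls_X ^ i) $$ (- int n)"
    using assms by simp
  also have "\<dots> = (if i = n then 1 else 0)"
    by (simp add: fls_inverse_X)
  finally show ?thesis .
qed

text \<open>Two poles differ by a nonzero element \<open>e l * h\<close> of \<open>U\<close>; after a partial fraction
  decomposition, the sum over the scalar \<open>l\<close> is a power sum over the finite field, which leaves
  the exponents divisible by \<open>q - 1\<close>.\<close>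

lemma pole_sum_mult:
  fixes e :: "'a::{finite,field} \<Rightarrow> 'k::field"
  assumes e: "field_hom e" and U: "finite U" "0 \<in> U"
    and plus: "\<And>x y. x \<in> U \<Longrightarrow> y \<in> U \<Longrightarrow> x + y \<in> U"
    and minus: "\<And>x y. x \<in> U \<Longrightarrow> y \<in> U \<Longrightarrow> x - y \<in> U"
    and bij: "bij_betw (\<lambda>(l, h). e l * h) ((UNIV - {0}) \<times> H) (U - {0})"
    and ab: "1 \<le> a" "1 \<le> b"
  shows "pole_sum U a * pole_sum U b = pole_sum U (a + b)
    + (\<Sum>j\<in>{1..<a + b}. fls_const (e (delta_coeff a b j) * (\<Sum>h\<in>H. inverse h ^ j)) * pole_sum U (a + b - j))"
proof -
  let ?i = "\<lambda>c. inverse (fls_X + fls_const c)" and ?Q = "CARD('a) - 1"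
  define C where "C j = (\<lambda>a :: nat. of_nat ((j - 1) choose (a - 1)) :: 'k)" for j :: nat
  have shift: "(\<Sum>c\<in>U. f (c + d)) = (\<Sum>c\<in>U. f c)" if "d \<in> U" for d and f :: "'k \<Rightarrow> 'k fls"
    by (rule sum.reindex_bij_witness[where i = "\<lambda>c. c - d" and j = "\<lambda>c. c + d"]) (use that plus minus in auto)
  \<comment> \<open>The difference \<open>d\<close> of the two poles is fixed and \<open>c\<close>
    varies. As \<open>U\<close> is invariant under translation by \<open>d\<close>, both halves of
    the partial fractions yield the same pole sums.\<close>
  have pf: "(\<Sum>c\<in>U. ?i c ^ a * ?i (c + d) ^ b)
      = (\<Sum>j\<in>{1..<a + b}. fls_const (((-1) ^ (j + b) * C j b + (-1) ^ a * C j a) * inverse d ^ j) * pole_sum U (a + b - j))"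
    if d: "d \<in> U - {0}" for d
  proof -
    have "?i c ^ a * ?i (c + d) ^ b = (\<Sum>j\<in>{1..<a + b}. ((-1) ^ (j + b) * of_nat ((j - 1) choose (b - 1)) * ?i c ^ (a + b - j)
        + (-1) ^ a * of_nat ((j - 1) choose (a - 1)) * ?i (c + d) ^ (a + b - j)) * inverse (fls_const d) ^ j)" for c
    proof (rule partial_fractions[OF _ ab])
      have eq: "fls_X + fls_const (c + d) = fls_X + fls_const c + fls_const d"
        by (simp add: fls_plus_const add.assoc)
      have "inverse f * inverse g = inverse h * (inverse f - inverse g)"
        if "g = f + h" "f \<noteq> 0" "g \<noteq> 0" "h \<noteq> 0" for f g h :: "'k fls"
        using that(2-) by (simp add: field_simps) (simp add: that(1))
      from this[OF eq] show "?i c * ?i (c + d) = inverse (fls_const d) * (?i c - ?i (c + d))"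
        using d by (simp only: fls_X_plus_const_nonzero fls_const_eq_0_iff) simp
    qed
    then have "(\<Sum>c\<in>U. ?i c ^ a * ?i (c + d) ^ b)
      = (\<Sum>j\<in>{1..<a + b}. \<Sum>c\<in>U. ((-1) ^ (j + b) * of_nat ((j - 1) choose (b - 1)) * ?i c ^ (a + b - j)
        + (-1) ^ a * of_nat ((j - 1) choose (a - 1)) * ?i (c + d) ^ (a + b - j)) * inverse (fls_const d) ^ j)"
      by (subst sum.swap) simp
    also have "\<dots> = (\<Sum>j\<in>{1..<a + b}. fls_const (((-1) ^ (j + b) * C j b + (-1) ^ a * C j a) * inverse d ^ j) * pole_sum U (a + b - j))"
    proof (rule sum.cong[OF refl])
      fix j
      have const: "fls_const (((-1) ^ (j + b) * C j b + (-1) ^ a * C j a) * inverse d ^ j)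
        = ((-1) ^ (j + b) * of_nat ((j - 1) choose (b - 1)) + (-1) ^ a * of_nat ((j - 1) choose (a - 1))) * inverse (fls_const d) ^ j"
        unfolding C_def by (simp only: field_hom_simps[OF field_hom_fls_const])
      have "(\<Sum>c\<in>U. ((-1) ^ (j + b) * of_nat ((j - 1) choose (b - 1)) * ?i c ^ (a + b - j)
        + (-1) ^ a * of_nat ((j - 1) choose (a - 1)) * ?i (c + d) ^ (a + b - j)) * inverse (fls_const d) ^ j)
        = ((-1) ^ (j + b) * of_nat ((j - 1) choose (b - 1)) * (\<Sum>c\<in>U. ?i c ^ (a + b - j))
        + (-1) ^ a * of_nat ((j - 1) choose (a - 1)) * (\<Sum>c\<in>U. ?i (c + d) ^ (a + b - j))) * inverse (fls_const d) ^ j"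
        by (simp only: sum_distrib_left sum_distrib_right sum.distrib distrib_right)
      also have "(\<Sum>c\<in>U. ?i (c + d) ^ (a + b - j)) = (\<Sum>c\<in>U. ?i c ^ (a + b - j))"
        using shift[of d "\<lambda>c. ?i c ^ (a + b - j)"] d by simp
      finally show "(\<Sum>c\<in>U. ((-1) ^ (j + b) * of_nat ((j - 1) choose (b - 1)) * ?i c ^ (a + b - j)
        + (-1) ^ a * of_nat ((j - 1) choose (a - 1)) * ?i (c + d) ^ (a + b - j)) * inverse (fls_const d) ^ j)
        = fls_const (((-1) ^ (j + b) * C j b + (-1) ^ a * C j a) * inverse d ^ j) * pole_sum U (a + b - j)"
        unfolding const pole_sum_def by (simp only: algebra_simps)
    qed
    finally show ?thesis .
  qed
  have coeff: "((-1) ^ (j + b) * C j b + (-1) ^ a * C j a) * (\<Sum>d\<in>U - {0}. inverse d ^ j)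
      = e (delta_coeff a b j) * (\<Sum>h\<in>H. inverse h ^ j)" if j: "j \<in> {1..<a + b}" for j
  proof -
    have "(\<Sum>d\<in>U - {0}. inverse d ^ j) = (\<Sum>(l, h)\<in>(UNIV - {0}) \<times> H. inverse (e l * h) ^ j)"
      using sum.reindex_bij_betw[OF bij, of "\<lambda>d. inverse d ^ j"] by (simp add: case_prod_unfold)
    also have "\<dots> = (\<Sum>l\<in>UNIV - {0}. \<Sum>h\<in>H. e (inverse l ^ j) * inverse h ^ j)"
      by (subst sum.cartesian_product[symmetric])
        (simp add: field_hom_simps[OF e] power_mult_distrib mult.commute)
    also have "\<dots> = e (\<Sum>l\<in>UNIV - {0}. inverse l ^ j) * (\<Sum>h\<in>H. inverse h ^ j)"
      by (simp add: field_hom_sum[OF e] sum_product)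
    also have "\<dots> = (if ?Q dvd j then - 1 else 0) * (\<Sum>h\<in>H. inverse h ^ j)"
      by (simp add: sum_inverse_power_finite_field field_hom_simps[OF e])
    finally have 1: "(\<Sum>d\<in>U - {0}. inverse d ^ j) = (if ?Q dvd j then - 1 else 0) * (\<Sum>h\<in>H. inverse h ^ j)" .
    show ?thesis
    proof (cases "?Q dvd j")
      case True
      \<comment> \<open>Since \<open>-1\<close> is a nonzero scalar, \<open>(-1) ^ j = 1\<close> in
        every characteristic. The value \<open>-1\<close> of the power sum then turns
        \<open>(-1) ^ a\<close> into the \<open>(-1) ^ (a - 1)\<close> of
        \<open>delta_coeff\<close>, and likewise for \<open>b\<close>.\<close>
      have "(-1 :: 'a) ^ ?Q = 1" by (rule finite_field_power_card) simp
      then have "(-1 :: 'a) ^ j = 1" using True by (auto simp: power_mult elim!: dvdE)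
      then have "e ((-1) ^ j) = 1" by (simp add: field_homD[OF e])
      then have sgn: "(-1 :: 'k) ^ j = 1" by (simp add: field_hom_simps[OF e])
      have neg: "(-1) ^ (m - 1) = - ((-1) ^ m :: 'k)" if "1 \<le> m" for m
        using that by (cases m) auto
      have "e (delta_coeff a b j) = - ((-1) ^ (j + b) * C j b + (-1) ^ a * C j a)"
        using True j sgn by (simp add: delta_coeff_def C_def field_hom_simps[OF e] neg[OF ab(1), simplified]
            neg[OF ab(2), simplified] power_add algebra_simps)
      then show ?thesis
        by (simp only: 1 True if_True mult_minus_left mult_minus_right mult_1)
    next
      case False
      then show ?thesis using 1 by (simp add: delta_coeff_def field_hom_zero[OF e])
    qed
  qed
  have "pole_sum U a * pole_sum U b = (\<Sum>c\<in>U. \<Sum>d\<in>U. ?i c ^ a * ?i d ^ b)"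
    by (simp add: pole_sum_def sum_product)
  \<comment> \<open>Replacing \<open>d\<close> by \<open>c + d\<close> sorts the pairs of poles by
    their difference; difference 0 will give \<open>pole_sum U (a + b)\<close>.\<close>
  also have "\<dots> = (\<Sum>c\<in>U. \<Sum>d\<in>U. ?i c ^ a * ?i (c + d) ^ b)"
  proof (rule sum.cong[OF refl])
    fix c assume "c \<in> U"
    then show "(\<Sum>d\<in>U. ?i c ^ a * ?i d ^ b) = (\<Sum>d\<in>U. ?i c ^ a * ?i (c + d) ^ b)"
      using shift[of c "\<lambda>d. ?i c ^ a * ?i d ^ b"] by (simp add: add.commute)
  qed
  also have "\<dots> = (\<Sum>d\<in>U. \<Sum>c\<in>U. ?i c ^ a * ?i (c + d) ^ b)"
    by (rule sum.swap)
  also have "\<dots> = (\<Sum>c\<in>U. ?i c ^ a * ?i (c + 0) ^ b) + (\<Sum>d\<in>U - {0}. \<Sum>c\<in>U. ?i c ^ a * ?i (c + d) ^ b)"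
    using U by (rule sum.remove)
  also have "(\<Sum>c\<in>U. ?i c ^ a * ?i (c + 0) ^ b) = pole_sum U (a + b)"
    by (simp add: pole_sum_def power_add)
  also have "(\<Sum>d\<in>U - {0}. \<Sum>c\<in>U. ?i c ^ a * ?i (c + d) ^ b)
      = (\<Sum>j\<in>{1..<a + b}. \<Sum>d\<in>U - {0}. fls_const (((-1) ^ (j + b) * C j b + (-1) ^ a * C j a) * inverse d ^ j) * pole_sum U (a + b - j))"
    by (subst sum.swap) (rule sum.cong[OF refl pf])
  also have "\<dots> = (\<Sum>j\<in>{1..<a + b}. fls_const (e (delta_coeff a b j) * (\<Sum>h\<in>H. inverse h ^ j)) * pole_sum U (a + b - j))"
  proof (rule sum.cong[OF refl])
    fix j assume "j \<in> {1..<a + b}"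
    show "(\<Sum>d\<in>U - {0}. fls_const (((-1) ^ (j + b) * C j b + (-1) ^ a * C j a) * inverse d ^ j) * pole_sum U (a + b - j))
      = fls_const (e (delta_coeff a b j) * (\<Sum>h\<in>H. inverse h ^ j)) * pole_sum U (a + b - j)"
      unfolding coeff[OF \<open>j \<in> _\<close>, symmetric]
      by (simp only: sum_distrib_left sum_distrib_right field_hom_sum[OF field_hom_fls_const])
  qed
  finally show ?thesis .
qed

section \<open>Evaluation of words of depth at most three\<close>

text \<open>A letter in second position is sent to the sum of \<open>h\<^sup>-\<^sup>j\<close> over representatives \<open>h\<close> of the
  lines of \<open>plane\<close>, namely \<open>h = 1\<close> and \<open>h = X + m\<close> for scalars \<open>m\<close>; this is \<open>1 + pole2 j\<close>. A letter
  in third position only sees the line of constants and is sent to 1.\<close>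

definition pole2 :: "nat \<Rightarrow> 'a::{finite,field} fls" where
  "pole2 i = pole_sum UNIV i"

definition plane :: "'a::{finite,field} fls set" where
  "plane = range (\<lambda>(m, n). fls_const m + fls_const n * fls_X)"

definition pole3 :: "nat \<Rightarrow> 'a::{finite,field} fls fls" where
  "pole3 i = pole_sum plane i"

text \<open>Here \<open>U\<close> is the scalar field, a single line with representative
  \<open>h = 1\<close>, so each power sum over \<open>H\<close> equals 1.\<close>

lemma pole2_mult:
  assumes "1 \<le> a" "1 \<le> b"
  shows "pole2 a * pole2 b = pole2 (a + b)
    + (\<Sum>j\<in>{1..<a + b}. fls_const (delta_coeff a b j) * pole2 (a + b - j) :: 'a::{finite,field} fls)"
proof -
  have "bij_betw (\<lambda>(l, h). l * h) ((UNIV - {0}) \<times> {1 :: 'a}) (UNIV - {0})"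
    by (rule bij_betwI[where g = "\<lambda>x. (x, 1)"]) auto
  from pole_sum_mult[OF field_hom_id _ _ _ _ this assms] show ?thesis
    by (simp add: pole2_def)
qed

lemma pole3_mult:
  assumes "1 \<le> a" "1 \<le> b"
  shows "pole3 a * pole3 b = pole3 (a + b)
    + (\<Sum>j\<in>{1..<a + b}. fls_const (fls_const (delta_coeff a b j) * (1 + pole2 j)) * pole3 (a + b - j)
        :: 'a::{finite,field} fls fls)"
proof -
  let ?H = "insert 1 (range (\<lambda>m :: 'a. fls_X + fls_const m))"
  have inj: "inj (\<lambda>m :: 'a. fls_X + fls_const m)"
    by (rule injI) (simp add: fls_eq_iff, metis)
  have one: "1 \<notin> range (\<lambda>m :: 'a. fls_X + fls_const m)"
  proof
    assume "1 \<in> range (\<lambda>m :: 'a. fls_X + fls_const m)"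
    then obtain m :: 'a where "1 = fls_X + fls_const m" by blast
    from arg_cong[OF this, of "\<lambda>f. f $$ 1"] show False by simp
  qed
  have eq_iff: "fls_const m + fls_const n * fls_X = fls_const m' + fls_const n' * fls_X \<longleftrightarrow> m = m' \<and> n = n'"
    for m n m' n' :: 'a
  proof
    assume *: "fls_const m + fls_const n * fls_X = fls_const m' + fls_const n' * fls_X"
    show "m = m' \<and> n = n'"
      using arg_cong[OF *, of "\<lambda>f. f $$ 0"] arg_cong[OF *, of "\<lambda>f. f $$ 1"] by simp
  qed simp
  have scale: "fls_const l * 1 = fls_const l + fls_const 0 * fls_X"
    "fls_const l * (fls_X + fls_const m) = fls_const (l * m) + fls_const l * fls_X" for l m :: 'a
    by (simp_all add: algebra_simps fls_const_mult_const)
  \<comment> \<open>The scalar \<open>l\<close> is the coefficient of \<open>X\<close> if that is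
    nonzero, and the constant term otherwise; this makes the factorization unique.\<close>
  have bij: "bij_betw (\<lambda>(l, h). fls_const l * h) ((UNIV - {0 :: 'a}) \<times> ?H) (plane - {0})"
    unfolding bij_betw_def
  proof
    show "inj_on (\<lambda>(l, h). fls_const l * h) ((UNIV - {0 :: 'a}) \<times> ?H)"
    proof (rule inj_onI)
      fix x y assume x: "x \<in> (UNIV - {0 :: 'a}) \<times> ?H" and y: "y \<in> (UNIV - {0 :: 'a}) \<times> ?H"
        and xy: "(\<lambda>(l, h). fls_const l * h) x = (\<lambda>(l, h). fls_const l * h) y"
      obtain l h l' h' where eq: "x = (l, h)" "y = (l', h')"
        by (metis surj_pair)
      have *: "l \<noteq> 0" "l' \<noteq> 0" "fls_const l * h = fls_const l' * h'"
        using x y xy by (simp_all add: eq)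
      have "h \<in> ?H" "h' \<in> ?H" using x y by (simp_all add: eq)
      then consider "h = 1" "h' = 1" | m where "h = 1" "h' = fls_X + fls_const m"
        | m where "h = fls_X + fls_const m" "h' = 1"
        | m m' where "h = fls_X + fls_const m" "h' = fls_X + fls_const m'"
        by blast
      then show "x = y"
        unfolding eq by cases (use * in \<open>simp_all only: scale eq_iff\<close>, auto)
    qed
    show "(\<lambda>(l, h). fls_const l * h) ` ((UNIV - {0 :: 'a}) \<times> ?H) = plane - {0}"
    proof (intro equalityI subsetI)
      fix x assume "x \<in> (\<lambda>(l, h). fls_const l * h) ` ((UNIV - {0 :: 'a}) \<times> ?H)"
      then obtain l h where x: "x = fls_const l * h" "l \<noteq> 0" "h \<in> ?H" by auto
      then have "x \<noteq> 0" by auto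
      moreover from x(3) consider "h = 1" | m where "h = fls_X + fls_const m" by blast
      then have "x \<in> plane"
      proof cases
        case 1
        show ?thesis unfolding x(1) 1 scale plane_def by (rule range_eqI[of _ _ "(l, 0)"]) simp
      next
        case 2
        show ?thesis unfolding x(1) 2 scale plane_def by (rule range_eqI[of _ _ "(l * m, l)"]) simp
      qed
      ultimately show "x \<in> plane - {0}" by simp
    next
      fix x :: "'a fls" assume "x \<in> plane - {0}"
      then obtain m n where x: "x = fls_const m + fls_const n * fls_X" "x \<noteq> 0"
        by (auto simp: plane_def)
      show "x \<in> (\<lambda>(l, h). fls_const l * h) ` ((UNIV - {0 :: 'a}) \<times> ?H)"
      proof (cases "n = 0")
        case True
        then have "m \<noteq> 0" using x by auto
        then show ?thesis using True x by (intro image_eqI[of _ _ "(m, 1)"]) auto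
      next
        case False
        then show ?thesis unfolding x(1)
          by (intro image_eqI[of _ _ "(n, fls_X + fls_const (m / n))"]) (auto simp: scale(2))
      qed
    qed
  qed
  have Hsum: "(\<Sum>h\<in>?H. inverse h ^ j) = 1 + pole2 j" for j
    using one by (simp add: pole2_def pole_sum_def sum.reindex[OF inj])
  have "finite (plane :: 'a fls set)" by (simp add: plane_def)
  moreover have "0 \<in> (plane :: 'a fls set)"
    unfolding plane_def by (rule range_eqI[of _ _ "(0, 0)"]) simp
  moreover have "x + y \<in> plane" "x - y \<in> plane" if in_plane: "x \<in> plane" "y \<in> plane" for x y :: "'a fls"
  proof -
    obtain m n m' n' where xy: "x = fls_const m + fls_const n * fls_X" "y = fls_const m' + fls_const n' * fls_X"
      using in_plane by (auto simp: plane_def)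
    show "x + y \<in> plane" unfolding plane_def xy
      by (rule range_eqI[of _ _ "(m + m', n + n')"]) (simp add: algebra_simps flip: fls_plus_const)
    show "x - y \<in> plane" unfolding plane_def xy
      by (rule range_eqI[of _ _ "(m - m', n - n')"]) (simp add: algebra_simps flip: fls_minus_const)
  qed
  ultimately show ?thesis
    using pole_sum_mult[OF field_hom_fls_const _ _ _ _ bij assms] by (simp add: pole3_def Hsum)
qed

text \<open>The counterpart of \<open>linext\<close> for values in a field that contains the scalars
  through \<open>e\<close>, where products of values make sense.\<close>

definition linear_eval :: "('a::field \<Rightarrow> 'k::field) \<Rightarrow> ('x \<Rightarrow> 'k) \<Rightarrow> ('x \<Rightarrow>\<^sub>0 'a) \<Rightarrow> 'k" where
  "linear_eval e f p = (\<Sum>u\<in>keys p. e (lookup p u) * f u)"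

lemma linear_eval_superset:
  assumes "field_hom e" "finite A" "keys p \<subseteq> A"
  shows "linear_eval e f p = (\<Sum>u\<in>A. e (lookup p u) * f u)"
  unfolding linear_eval_def using assms(2,3)
  by (intro sum.mono_neutral_left) (auto simp: in_keys_iff field_hom_zero[OF assms(1)])

lemma linear_eval_add:
  fixes p r :: "'x \<Rightarrow>\<^sub>0 'a::field"
  assumes e: "field_hom e"
  shows "linear_eval e f (p + r) = linear_eval e f p + linear_eval e f r"
proof -
  let ?A = "keys p \<union> keys r"
  have "linear_eval e f (p + r) = (\<Sum>u\<in>?A. e (lookup (p + r) u) * f u)"
    by (rule linear_eval_superset[OF e]) (auto dest: subsetD[OF Poly_Mapping.keys_add])
  also have "\<dots> = (\<Sum>u\<in>?A. e (lookup p u) * f u) + (\<Sum>u\<in>?A. e (lookup r u) * f u)"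
    by (simp add: lookup_add field_homD[OF e] algebra_simps sum.distrib)
  also have "\<dots> = linear_eval e f p + linear_eval e f r"
    by (subst (1 2) linear_eval_superset[OF e, where A = ?A]) auto
  finally show ?thesis .
qed

lemma linear_eval_smul:
  assumes e: "field_hom e"
  shows "linear_eval e f (smul c p) = e c * linear_eval e f p"
proof -
  have "linear_eval e f (smul c p) = (\<Sum>u\<in>keys p. e (lookup (smul c p) u) * f u)"
    by (rule linear_eval_superset[OF e]) (auto dest: subsetD[OF keys_smul])
  then show ?thesis
    by (simp add: linear_eval_def field_homD[OF e] sum_distrib_left mult.assoc)
qed

lemma linear_eval_basis [simp]: "field_hom e \<Longrightarrow> linear_eval e f (basis u) = f u"
  by (simp add: linear_eval_def keys_basis lookup_basis field_homD[of e])

lemma linear_eval_zero [simp]: "linear_eval e f 0 = 0"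
  by (simp add: linear_eval_def)

lemma linear_eval_sum: "field_hom e \<Longrightarrow> linear_eval e f (\<Sum>i\<in>I. g i) = (\<Sum>i\<in>I. linear_eval e f (g i))"
  by (induction I rule: infinite_finite_induct) (simp_all add: linear_eval_add[of e])

lemmas linear_eval_simps = linear_eval_add[OF field_hom_fls_const] linear_eval_smul[OF field_hom_fls_const]
  linear_eval_sum[OF field_hom_fls_const] linear_eval_basis[OF field_hom_fls_const]

text \<open>Below the line of constants, \<open>h = 1\<close>, there is no smaller nonzero space. So
  only the representatives \<open>X + m\<close> contribute when another letter follows, and a tail
  of three letters gives 0.\<close>

fun tail_eval :: "word \<Rightarrow> 'a::{finite,field} fls" where
  "tail_eval [] = 1"
| "tail_eval [j] = 1 + pole2 j"
| "tail_eval [j, k] = pole2 j"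
| "tail_eval _ = 0"

text \<open>The two concatenations give \<open>pole2 j + pole2 k\<close>, and by
  \<open>pole2_mult\<close> the diamond product gives \<open>1 + pole2 j * pole2 k\<close>.\<close>

lemma tail_eval_shuffle_letters:
  assumes "1 \<le> j" "1 \<le> k"
  shows "linear_eval fls_const tail_eval (shuffle (letter j) (letter k))
    = (tail_eval [j] * tail_eval [k] :: 'a::{finite,field} fls)"
  unfolding shuffle_basis shuffle_word_Cons
  by (simp add: merge_def linear_eval_simps pole2_mult[OF assms] algebra_simps)

fun word_eval :: "word \<Rightarrow> 'a::{finite,field} fls fls" where
  "word_eval [] = 0"
| "word_eval (i # w) = pole3 i * fls_const (tail_eval w)"

abbreviation eval3 :: "'a::{finite,field} wordspace \<Rightarrow> 'a fls fls" where
  "eval3 \<equiv> linear_eval (\<lambda>x. fls_const (fls_const x)) word_eval"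

lemma field_hom_fls_const_const: "field_hom (\<lambda>x. fls_const (fls_const x))"
  by (simp add: field_hom_def fls_plus_const fls_const_mult_const)

lemmas eval3_simps = linear_eval_add[OF field_hom_fls_const_const] linear_eval_smul[OF field_hom_fls_const_const]
  linear_eval_sum[OF field_hom_fls_const_const] linear_eval_basis[OF field_hom_fls_const_const]

lemma eval3_prepend: "eval3 (prepend i p) = pole3 i * fls_const (linear_eval fls_const tail_eval p)"
proof -
  have "eval3 (prepend i p) = (\<Sum>u\<in>keys p. fls_const (fls_const (lookup p u)) * (pole3 i * fls_const (tail_eval u)))"
    unfolding prepend_def linext_def by (simp add: eval3_simps)
  then show ?thesis
    by (simp add: linear_eval_def field_hom_sum[OF field_hom_fls_const] sum_distrib_left
        mult.left_commute flip: fls_const_mult_const)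
qed

text \<open>The hypothesis on \<open>p\<close> pulls the value of \<open>p\<close> out of every
  summand, and what remains is the right-hand side of \<open>pole3_mult\<close>. It will be met by
  the empty word and by single letters.\<close>

lemma eval3_merge:
  fixes p :: "'a::{finite,field} wordspace"
  assumes ab: "1 \<le> a" "1 \<le> b" and p: "\<And>j. 1 \<le> j \<Longrightarrow>
    linear_eval fls_const tail_eval (shuffle (letter j) p) = (1 + pole2 j) * linear_eval fls_const tail_eval p"
  shows "eval3 (merge a b p) = pole3 a * pole3 b * fls_const (linear_eval fls_const tail_eval p)"
proof -
  have "(\<Sum>j\<in>{1..<a + b}. fls_const (fls_const (delta_coeff a b j)) *
      (pole3 (a + b - j) * fls_const (linear_eval fls_const tail_eval (shuffle (letter j) p))))
    = (\<Sum>j\<in>{1..<a + b}. fls_const (fls_const (delta_coeff a b j) * (1 + pole2 j)) * pole3 (a + b - j))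
      * fls_const (linear_eval fls_const tail_eval p)"
    unfolding sum_distrib_right
    by (intro sum.cong refl) (subst p, simp, simp only: field_homD(3)[OF field_hom_fls_const] mult_ac)
  then show ?thesis
    by (simp add: merge_def eval3_simps eval3_prepend pole3_mult[OF ab] distrib_right)
qed

text \<open>The diamond product of three nonempty words with first letters \<open>a\<close>, \<open>b\<close>, \<open>c\<close>,
  as a function of the shuffle product \<open>p\<close> of their tails.\<close>

definition merge3 :: "nat \<Rightarrow> nat \<Rightarrow> nat \<Rightarrow> 'a::{finite,field} wordspace \<Rightarrow> 'a wordspace" where
  "merge3 a b c p = merge (a + b) c p
     + (\<Sum>j\<in>{1..<a + b}. smul (delta_coeff a b j) (merge (a + b - j) c (shuffle (letter j) p)))"

text \<open>The rule \<open>eval3_merge\<close> removes \<open>c\<close>, and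
  \<open>pole3_mult\<close> then reassembles \<open>a\<close> and \<open>b\<close>. The point is the
  symmetry of the value in all three letters.\<close>

lemma eval3_merge3:
  assumes abc: "1 \<le> a" "1 \<le> b" "1 \<le> c"
  shows "eval3 (merge3 a b c (basis [])) = pole3 a * pole3 b * pole3 c"
proof -
  have 1: "eval3 (merge (a + b) c (basis [])) = pole3 (a + b) * pole3 c"
    using abc by (subst eval3_merge) (simp_all add: linear_eval_simps)
  have 2: "eval3 (merge (a + b - j) c (letter j)) = pole3 (a + b - j) * pole3 c * fls_const (1 + pole2 j)"
    if "j \<in> {1..<a + b}" for j
    using abc that by (subst eval3_merge) (auto simp: linear_eval_simps tail_eval_shuffle_letters)
  have "eval3 (merge3 a b c (basis [])) = pole3 (a + b) * pole3 c
    + (\<Sum>j\<in>{1..<a + b}. fls_const (fls_const (delta_coeff a b j)) * (pole3 (a + b - j) * pole3 c * fls_const (1 + pole2 j)))"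
    by (simp add: merge3_def eval3_simps 1 2)
  also have "(\<Sum>j\<in>{1..<a + b}. fls_const (fls_const (delta_coeff a b j)) * (pole3 (a + b - j) * pole3 c * fls_const (1 + pole2 j)))
    = (\<Sum>j\<in>{1..<a + b}. fls_const (fls_const (delta_coeff a b j) * (1 + pole2 j)) * pole3 (a + b - j)) * pole3 c"
    unfolding sum_distrib_right
    by (intro sum.cong refl) (simp only: field_homD(3)[OF field_hom_fls_const] mult_ac)
  finally show ?thesis
    by (simp add: pole3_mult[OF abc(1,2)] distrib_right)
qed

section \<open>Weight and depth of merged letters\<close>

lemma keys_shuffle_words_of:
  fixes p r :: "'a::{finite,field} wordspace"
  assumes "keys p \<subseteq> words_of m k" "keys r \<subseteq> words_of n l"
  shows "keys (shuffle p r) \<subseteq> words_of (m + n) (k + l)"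
  unfolding shuffle_def
proof (rule keys_bilinext)
  fix u v assume "u \<in> keys p" "v \<in> keys r"
  then have "u \<in> words_of m k" "v \<in> words_of n l" using assms by auto
  then show "keys (shuffle_word u v :: 'a wordspace) \<subseteq> words_of (m + n) (k + l)"
    using keys_shuffle_word(2)[of u v, where 'a = 'a] by (fastforce simp: words_of_def)
qed

lemma keys_merge:
  fixes p :: "'a::{finite,field} wordspace"
  assumes p: "keys p \<subseteq> words_of n l" and ab: "1 \<le> a" "1 \<le> b"
  shows "keys (merge a b p) \<subseteq> words_of (a + b + n) (Suc (Suc l))"
proof -
  have "keys (prepend (a + b) p) \<subseteq> words_of (a + b + n) (Suc (Suc l))"
    using keys_prepend_words_of[OF p, of "a + b"] ab by (fastforce simp: words_of_def)
  moreover have "keys (prepend (a + b - j) (shuffle (letter j) p)) \<subseteq> words_of (a + b + n) (Suc (Suc l))"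
    if j: "j \<in> {1..<a + b}" for j
  proof -
    have "keys (letter j :: 'a wordspace) \<subseteq> words_of j 1"
      using j by (auto simp: keys_basis words_of_def)
    from keys_prepend_words_of[OF keys_shuffle_words_of[OF this p], of "a + b - j"]
    have "keys (prepend (a + b - j) (shuffle (letter j) p)) \<subseteq> words_of (a + b - j + (j + n)) (Suc (1 + l))"
      using j by fastforce
    then show ?thesis using j by (simp add: add_ac)
  qed
  ultimately show ?thesis
    unfolding merge_def by (intro keys_subset_intros)
qed

lemma keys_merge3:
  assumes "1 \<le> a" "1 \<le> b" "1 \<le> c"
  shows "keys (merge3 a b c (basis []) :: 'a::{finite,field} wordspace) \<subseteq> words_of (a + b + c) 3"
proof -
  have "keys (basis [] :: 'a wordspace) \<subseteq> words_of 0 0"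
    by (simp add: keys_basis words_of_def)
  from keys_merge[OF this, of "a + b" c] have "keys (merge (a + b) c (basis []) :: 'a wordspace) \<subseteq> words_of (a + b + c) 3"
    using assms by (fastforce simp: words_of_def)
  moreover have "keys (merge (a + b - j) c (letter j) :: 'a wordspace) \<subseteq> words_of (a + b + c) 3"
    if j: "j \<in> {1..<a + b}" for j
  proof -
    have "keys (letter j :: 'a wordspace) \<subseteq> words_of j 1"
      using j by (auto simp: keys_basis words_of_def)
    from keys_merge[OF this, of "a + b - j" c]
    have "keys (merge (a + b - j) c (letter j) :: 'a wordspace) \<subseteq> words_of (a + b - j + c + j) (Suc (Suc 1))"
      using j assms(3) by fastforce
    then show ?thesis using j by (simp add: numeral_3_eq_3)
  qed
  ultimately show ?thesis
    unfolding merge3_def shuffle_Nil by (intro keys_subset_intros)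
qed

section \<open>Recovering a word from its evaluation\<close>

fun word_coeff :: "word \<Rightarrow> 'a::{finite,field} fls fls \<Rightarrow> 'a" where
  "word_coeff (i # j # w) x = x $$ (- int i) $$ (- int j)"
| "word_coeff [i] x = x $$ (- int i) $$ 0"
| "word_coeff [] x = 0"

lemma word_coeff_eval3:
  "word_coeff w (eval3 p) = (\<Sum>u\<in>keys p. lookup p u * word_coeff w (word_eval u))"
  unfolding linear_eval_def
  by (induction w "eval3 p" rule: word_coeff.induct) (simp_all add: fls_nth_sum)

lemma pole2_nth: "1 \<le> i \<Longrightarrow> 1 \<le> n \<Longrightarrow> pole2 i $$ (- int n) = (if i = n then 1 else 0)"
  unfolding pole2_def by (rule pole_sum_nth) auto

lemma pole3_nth: "1 \<le> i \<Longrightarrow> 1 \<le> n \<Longrightarrow> pole3 i $$ (- int n) = (if i = n then 1 else 0)"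
  unfolding pole3_def plane_def by (rule pole_sum_nth) (auto intro!: range_eqI[of _ _ "(0, 0)"])

lemma sum_list_words_eq_0: "w \<in> words \<Longrightarrow> sum_list w = 0 \<longleftrightarrow> w = []"
  by (cases w) auto

text \<open>At fixed weight and depth at most three, the first two letters determine a word. The
  principal parts of \<open>pole3\<close> and \<open>pole2\<close> detect these letters; a word of
  one letter is detected by the constant term of \<open>tail_eval [] = 1\<close>.\<close>

lemma word_coeff_word_eval:
  assumes "w \<in> words_of n 3" "u \<in> words_of n 3" "0 < n"
  shows "word_coeff w (word_eval u) = (if w = u then 1 else (0 :: 'a::{finite,field}))"
proof -
  obtain i w' where w: "w = i # w'" using assms by (cases w) (auto simp: words_of_def)
  obtain k u' where u: "u = k # u'" using assms by (cases u) (auto simp: words_of_def)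
  have coeff: "(word_eval u :: 'a fls fls) $$ (- int i) = (if i = k then tail_eval u' else 0)"
    using assms pole3_nth[of k i, where 'a = 'a] by (auto simp: w u words_of_def)
  show ?thesis
  proof (cases w')
    case Nil
    then have "i = k \<longleftrightarrow> w = u"
      using assms sum_list_words_eq_0[of u'] by (auto simp: w u words_of_def)
    then show ?thesis using coeff by (auto simp: w u Nil)
  next
    case (Cons j w'')
    have j: "1 \<le> j" using assms by (auto simp: w Cons words_of_def)
    have "(tail_eval u' :: 'a fls) $$ (- int j) = (if w = u then 1 else 0)" if "i = k"
    proof -
      consider "u' = []" | l where "u' = [l]" | l m where "u' = [l, m]"
        using assms by (auto simp: u words_of_def length_Suc_conv le_Suc_eq numeral_3_eq_3)
      then show ?thesis
      proof cases
        case 1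
        then show ?thesis using j by (auto simp: w u Cons)
      next
        case 2
        then have "l = j \<longleftrightarrow> w = u"
          using assms sum_list_words_eq_0[of w''] that by (auto simp: w u Cons words_of_def)
        moreover have "1 \<le> l" using assms by (auto simp: u 2 words_of_def)
        ultimately show ?thesis using j pole2_nth[of l j, where 'a = 'a] by (auto simp: 2)
      next
        case 3
        have "w'' = [] \<or> (\<exists>m'. w'' = [m'])"
          using assms by (auto simp: w Cons words_of_def length_Suc_conv le_Suc_eq numeral_3_eq_3)
        then have "l = j \<longleftrightarrow> w = u"
          using assms that by (auto simp: w u Cons 3 words_of_def)
        moreover have "1 \<le> l" using assms by (auto simp: u 3 words_of_def)
        ultimately show ?thesis using j pole2_nth[of l j, where 'a = 'a] by (auto simp: 3)
      qed
    qed
    then show ?thesis using coeff by (auto simp: w Cons u)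
  qed
qed

text \<open>The maps \<open>word_coeff w\<close> are dual to the words, so they recover every
  coefficient. Positive weight excludes the empty word, which is evaluated to 0.\<close>

lemma eval3_inject:
  fixes p r :: "'a::{finite,field} wordspace"
  assumes eq: "eval3 p = eval3 r" and keys: "keys p \<subseteq> words_of n 3" "keys r \<subseteq> words_of n 3" and n: "0 < n"
  shows "p = r"
proof (rule poly_mapping_eqI)
  have lookup: "lookup s w = word_coeff w (eval3 s)"
    if "keys s \<subseteq> words_of n 3" "w \<in> words_of n 3" for s :: "'a wordspace" and w
  proof -
    have "word_coeff w (eval3 s) = (\<Sum>u\<in>keys s. if w = u then lookup s u else 0)"
      unfolding word_coeff_eval3 using that
      by (intro sum.cong) (auto simp: word_coeff_word_eval[OF _ _ n])
    also have "\<dots> = lookup s w" by (simp add: in_keys_iff)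
    finally show ?thesis by simp
  qed
  fix w
  show "lookup p w = lookup r w"
  proof (cases "w \<in> words_of n 3")
    case True
    then show ?thesis using lookup eq keys by simp
  next
    case False
    then have "w \<notin> keys p" "w \<notin> keys r" using keys by auto
    then show ?thesis by (simp add: in_keys_iff)
  qed
qed

text \<open>Both sides evaluate to \<open>pole3 a * pole3 b * pole3 c\<close>, and evaluation is
  injective in this weight and depth.\<close>

lemma merge3_rotate_Nil:
  assumes "1 \<le> a" "1 \<le> b" "1 \<le> c"
  shows "merge3 a b c (basis []) = merge3 b c a (basis [])"
proof (rule eval3_inject)
  show "eval3 (merge3 a b c (basis [])) = eval3 (merge3 b c a (basis []))"
    using assms by (simp add: eval3_merge3 mult_ac)
  show "keys (merge3 a b c (basis [])) \<subseteq> words_of (a + b + c) 3"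
    using assms by (rule keys_merge3)
  show "keys (merge3 b c a (basis [])) \<subseteq> words_of (a + b + c) 3"
    using keys_merge3[of b c a] assms by (simp add: add_ac)
  show "0 < a + b + c" using assms by simp
qed

section \<open>Associativity of the shuffle product\<close>

definition triangle :: "'a::{finite,field} wordspace \<Rightarrow> 'a wordspace \<Rightarrow> 'a wordspace" where
  "triangle = bilinext triangle_word"

lemma lin_map_triangle_left: "lin_map (\<lambda>p. triangle p r)"
  unfolding triangle_def by (rule lin_map_bilinext_left)

lemma lin_map_triangle_right: "lin_map (triangle p)"
  unfolding triangle_def by (rule lin_map_bilinext_right)

lemmas triangle_left = lin_map_add[OF lin_map_triangle_left] lin_map_diff[OF lin_map_triangle_left]
  lin_map_smul[OF lin_map_triangle_left] lin_map_sum[OF lin_map_triangle_left]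
  lin_map_zero[OF lin_map_triangle_left]

lemma triangle_word_Cons: "triangle_word (a # u) v = prepend a (shuffle_word u v)"
  by (cases v) simp_all

lemma triangle_prepend: "triangle (prepend a p) r = prepend a (shuffle p r)"
proof (rule bilinext_eqI[where F = "\<lambda>p r. triangle (prepend a p) r" and G = "\<lambda>p r. prepend a (shuffle p r)"])
  fix u v
  show "triangle (prepend a (basis u)) (basis v) = prepend a (shuffle (basis u) (basis v))"
    by (simp only: prepend_basis triangle_def bilinext_basis triangle_word_Cons shuffle_basis)
qed (intro lin_map_intros lin_map_comp[OF _ lin_map_triangle_left] lin_map_triangle_right)+

lemma shuffle_rotate_extend:
  fixes p r s :: "'a::{finite,field} wordspace"
  assumes "\<And>u v w. u \<in> keys p \<Longrightarrow> v \<in> keys r \<Longrightarrow> w \<in> keys s \<Longrightarrow>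
    (shuffle (shuffle (basis u) (basis v)) (basis w) :: 'a wordspace)
      = shuffle (shuffle (basis v) (basis w)) (basis u)"
  shows "shuffle (shuffle p r) s = shuffle (shuffle r s) p"
proof (rule lin_map_eqI[where F = "\<lambda>p. shuffle (shuffle p r) s" and G = "\<lambda>p. shuffle (shuffle r s) p"])
  fix u assume u: "u \<in> keys p"
  show "shuffle (shuffle (basis u) r) s = shuffle (shuffle r s) (basis u)"
  proof (rule bilinext_eqI[where F = "\<lambda>r s. shuffle (shuffle (basis u) r) s"
        and G = "\<lambda>r s. shuffle (shuffle r s) (basis u)"])
    fix v w assume "v \<in> keys r" "w \<in> keys s"
    with u show "(shuffle (shuffle (basis u) (basis v)) (basis w) :: 'a wordspace) = shuffle (shuffle (basis v) (basis w)) (basis u)"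
      by (rule assms)
  qed (intro lin_map_intros)+
qed (intro lin_map_intros)+

text \<open>The hypotheses move the letter \<open>j\<close> out of the products. The terms in which
  \<open>c\<close> merges with a first letter of \<open>merge a b y\<close> then add up to
  \<open>merge3\<close>.\<close>

lemma shuffle_merge_prepend:
  assumes C: "\<And>j. j \<in> {1..<a + b} \<Longrightarrow>
      shuffle (shuffle (letter j) y) (prepend c r) = shuffle (letter j) (shuffle y (prepend c r))"
    and r: "\<And>j. j \<in> {1..<a + b} \<Longrightarrow> shuffle (shuffle (letter j) y) r = shuffle (letter j) (shuffle y r)"
  shows "shuffle (merge a b y) (prepend c r) = merge a b (shuffle y (prepend c r))
    + prepend c (shuffle (merge a b y) r) + merge3 a b c (shuffle y r)"
proof -
  have "shuffle (prepend (a + b - j) (shuffle (letter j) y)) (prepend c r)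
      = prepend (a + b - j) (shuffle (letter j) (shuffle y (prepend c r)))
        + prepend c (shuffle (prepend (a + b - j) (shuffle (letter j) y)) r)
        + merge (a + b - j) c (shuffle (letter j) (shuffle y r))" if "j \<in> {1..<a + b}" for j
    unfolding shuffle_prepend C[OF that] r[OF that] ..
  then have "shuffle (merge a b y) (prepend c r) = shuffle (prepend (a + b) y) (prepend c r)
      + (\<Sum>j\<in>{1..<a + b}. smul (delta_coeff a b j) (prepend (a + b - j) (shuffle (letter j) (shuffle y (prepend c r)))
        + prepend c (shuffle (prepend (a + b - j) (shuffle (letter j) y)) r)
        + merge (a + b - j) c (shuffle (letter j) (shuffle y r))))"
    by (simp add: merge_def[of a b] shuffle_left)
  then show ?thesis
    unfolding shuffle_prepend merge3_def merge_def[of a b]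
    by (simp add: shuffle_left prepend_lin smul_add sum.distrib algebra_simps)
qed

text \<open>The triangle product with \<open>y\<close> attaches \<open>y\<close> to all tails, so
  the identity for the empty tail carries over. Tails contain at most two letters \<open>i\<close>
  and \<open>j\<close>, and the first letter takes up some weight, hence
  \<open>i + j < a + b + c\<close>.\<close>

lemma merge3_rotate:
  assumes y: "\<And>i j. 1 \<le> i \<Longrightarrow> 1 \<le> j \<Longrightarrow> i + j < a + b + c \<Longrightarrow>
      shuffle (shuffle (letter i) (letter j)) y = shuffle (letter i) (shuffle (letter j) y)"
    and abc: "1 \<le> a" "1 \<le> b" "1 \<le> c"
  shows "merge3 a b c y = merge3 b c a y"
proof -
  have merge: "triangle (merge a b (basis [])) y = merge a b y" for a b
    by (simp add: merge_def triangle_left triangle_prepend del: prepend_basis)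
  have "triangle (merge (a + b - j) c (letter j)) y = merge (a + b - j) c (shuffle (letter j) y)"
    if "j \<in> {1..<a + b}" "1 \<le> c"
      and y: "\<And>i j. 1 \<le> i \<Longrightarrow> 1 \<le> j \<Longrightarrow> i + j < a + b + c \<Longrightarrow>
        shuffle (shuffle (letter i) (letter j)) y = shuffle (letter i) (shuffle (letter j) y)"
    for a b c j
  proof -
    have "shuffle (shuffle (letter i) (letter j)) y = shuffle (letter i) (shuffle (letter j) y)"
      if "i \<in> {1..<a + b - j + c}" for i
      using that \<open>j \<in> _\<close> by (intro y) auto
    then show ?thesis
      by (simp add: merge_def triangle_left triangle_prepend del: prepend_basis)
  qed
  then have merge3: "triangle (merge3 a b c (basis [])) y = merge3 a b c y"
    if "1 \<le> c" "\<And>i j. 1 \<le> i \<Longrightarrow> 1 \<le> j \<Longrightarrow> i + j < a + b + c \<Longrightarrow>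
        shuffle (shuffle (letter i) (letter j)) y = shuffle (letter i) (shuffle (letter j) y)"
    for a b c
    using that by (simp add: merge3_def triangle_left merge)
  have "merge3 a b c y = triangle (merge3 a b c (basis [])) y"
    by (rule merge3[symmetric]) (use abc y in auto)
  also have "\<dots> = triangle (merge3 b c a (basis [])) y"
    by (subst merge3_rotate_Nil[OF abc]) (rule refl)
  also have "\<dots> = merge3 b c a y"
    by (rule merge3) (use abc y in auto)
  finally show ?thesis .
qed

text \<open>Given commutativity, associativity is invariance of \<open>shuffle (shuffle p r) s\<close> under
  rotation of its arguments. Expanding it for three nonempty words gives terms that rotation
  permutes by the induction hypothesis, together with the term \<open>merge3\<close>.\<close>

lemma shuffle_rotate_words:
  assumes "u \<in> words" "v \<in> words" "w \<in> words"
  shows "(shuffle (shuffle (basis u) (basis v)) (basis w) :: 'a::{finite,field} wordspace)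
    = shuffle (shuffle (basis v) (basis w)) (basis u)"
  using assms
proof (induction "sum_list u + sum_list v + sum_list w" arbitrary: u v w rule: less_induct)
  case less
  let ?n = "sum_list u + sum_list v + sum_list w"
  have IH: "shuffle (shuffle x y) z = shuffle (shuffle y z) x"
    if "homog i x" "homog j y" "homog k z" "i + j + k < ?n" for x y z :: "'a wordspace" and i j k
  proof (rule shuffle_rotate_extend)
    fix u' v' w' assume "u' \<in> keys x" "v' \<in> keys y" "w' \<in> keys z"
    then have "u' \<in> words" "v' \<in> words" "w' \<in> words" "sum_list u' = i" "sum_list v' = j" "sum_list w' = k"
      using that(1-3) by (auto simp: homog_def)
    then show "(shuffle (shuffle (basis u') (basis v')) (basis w') :: 'a wordspace)
        = shuffle (shuffle (basis v') (basis w')) (basis u')"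
      using that(4) by (intro less.hyps) simp_all
  qed
  have assoc: "shuffle (shuffle x y) z = shuffle x (shuffle y z)"
    if "homog i x" "homog j y" "homog k z" "i + j + k < ?n" for x y z :: "'a wordspace" and i j k
    using IH[OF that] by (simp add: shuffle_commute)
  show ?case
  proof (cases "u = [] \<or> v = [] \<or> w = []")
    case True
    then show ?thesis by (auto simp: shuffle_commute)
  next
    case False
    then obtain a u' b v' c w' where uvw: "u = a # u'" "v = b # v'" "w = c # w'"
      by (meson neq_Nil_conv)
    have abc: "1 \<le> a" "1 \<le> b" "1 \<le> c" and words: "u' \<in> words" "v' \<in> words" "w' \<in> words"
      using less.prems by (auto simp: uvw)
    define p q r :: "'a wordspace" where "p = basis u'" and "q = basis v'" and "r = basis w'"
    define i j k where "i = sum_list u'" and "j = sum_list v'" and "k = sum_list w'"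
    have n: "?n = a + i + (b + j) + (c + k)" by (simp add: uvw i_def j_def k_def)
    have homog: "homog i p" "homog j q" "homog k r"
      using words by (simp_all add: p_def q_def r_def i_def j_def k_def homog_basis)
    let ?A = "prepend a p" and ?B = "prepend b q" and ?C = "prepend c r"
    have homog': "homog (a + i) ?A" "homog (b + j) ?B" "homog (c + k) ?C"
      using homog abc by (simp_all add: homog_prepend)
    \<comment> \<open>Letters and tails are kept general so that the expansion applies to the
      rotated triple too.\<close>
    have expand: "shuffle (shuffle (prepend a p) (prepend b q)) (prepend c r)
        = prepend a (shuffle (shuffle p (prepend b q)) (prepend c r))
        + prepend b (shuffle (shuffle (prepend a p) q) (prepend c r))
        + prepend c (shuffle (shuffle (prepend a p) (prepend b q)) r)
        + merge a c (shuffle (shuffle p (prepend b q)) r)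
        + merge b c (shuffle (shuffle (prepend a p) q) r)
        + merge a b (shuffle (shuffle p q) (prepend c r)) + merge3 a b c (shuffle (shuffle p q) r)"
      if "homog i p" "homog j q" "homog k r" "1 \<le> c" "?n = a + i + (b + j) + (c + k)"
      for a b c i j k and p q r :: "'a wordspace"
    proof -
      have "shuffle (merge a b (shuffle p q)) (prepend c r) = merge a b (shuffle (shuffle p q) (prepend c r))
        + prepend c (shuffle (merge a b (shuffle p q)) r) + merge3 a b c (shuffle (shuffle p q) r)"
      proof (rule shuffle_merge_prepend)
        \<comment> \<open>The letter \<open>l\<close> weighs less than \<open>a\<close> and
          \<open>b\<close> together, which brings the triples below into reach of the induction
          hypothesis.\<close>
        fix l assume l: "l \<in> {1..<a + b}"
        show "shuffle (shuffle (letter l) (shuffle p q)) (prepend c r) = shuffle (letter l) (shuffle (shuffle p q) (prepend c r))"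
          by (rule assoc[where i = l and j = "i + j" and k = "c + k"])
            (use that l in \<open>auto simp: homog_letter homog_shuffle homog_prepend\<close>)
        show "shuffle (shuffle (letter l) (shuffle p q)) r = shuffle (letter l) (shuffle (shuffle p q) r)"
          by (rule assoc[where i = l and j = "i + j" and k = k])
            (use that l in \<open>auto simp: homog_letter homog_shuffle homog_prepend\<close>)
      qed
      moreover have "shuffle (prepend a (shuffle p (prepend b q)) + prepend b (shuffle (prepend a p) q)) (prepend c r)
        = prepend a (shuffle (shuffle p (prepend b q)) (prepend c r))
        + prepend b (shuffle (shuffle (prepend a p) q) (prepend c r))
        + prepend c (shuffle (prepend a (shuffle p (prepend b q)) + prepend b (shuffle (prepend a p) q)) r)
        + merge a c (shuffle (shuffle p (prepend b q)) r)
        + merge b c (shuffle (shuffle (prepend a p) q) r)"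
        by (simp add: shuffle_left prepend_lin shuffle_prepend[of _ _ c] algebra_simps)
      ultimately show ?thesis
        unfolding shuffle_prepend[of a p b q]
        by (simp add: shuffle_left prepend_lin algebra_simps)
    qed
    have m3: "merge3 a b c (shuffle (shuffle p q) r) = merge3 b c a (shuffle (shuffle q r) p)"
    proof -
      have eq: "shuffle (shuffle p q) r = shuffle (shuffle q r) p"
        by (rule IH[OF homog]) (use n abc in auto)
      have "merge3 a b c (shuffle (shuffle p q) r) = merge3 b c a (shuffle (shuffle p q) r)"
      proof (rule merge3_rotate[OF _ abc])
        fix l m :: nat assume "1 \<le> l" "1 \<le> m" "l + m < a + b + c"
        then show "shuffle (shuffle (letter l) (letter m)) (shuffle (shuffle p q) r)
            = shuffle (letter l) (shuffle (letter m) (shuffle (shuffle p q) r))"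
          by (intro assoc[where i = l and j = m and k = "i + j + k"])
            (use n homog in \<open>auto simp: homog_letter homog_shuffle\<close>)
      qed
      then show ?thesis unfolding eq .
    qed
    \<comment> \<open>These are the six triples in which one or two first letters have been removed;
      they fill the \<open>prepend\<close> and two-letter \<open>merge\<close> terms of the
      expansion.\<close>
    have rot: "shuffle (shuffle p ?B) ?C = shuffle (shuffle ?B ?C) p"
        "shuffle (shuffle ?A q) ?C = shuffle (shuffle q ?C) ?A"
        "shuffle (shuffle ?A ?B) r = shuffle (shuffle ?B r) ?A"
        "shuffle (shuffle p ?B) r = shuffle (shuffle ?B r) p"
        "shuffle (shuffle ?A q) r = shuffle (shuffle q r) ?A"
        "shuffle (shuffle p q) ?C = shuffle (shuffle q ?C) p"
      by (rule IH[OF homog(1) homog'(2,3)] IH[OF homog'(1) homog(2) homog'(3)] IH[OF homog'(1,2) homog(3)]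
          IH[OF homog(1) homog'(2) homog(3)] IH[OF homog'(1) homog(2,3)] IH[OF homog(1,2) homog'(3)],
          use n abc in linarith)+
    have n': "?n = b + j + (c + k) + (a + i)" using n by simp
    have "shuffle (shuffle ?A ?B) ?C = shuffle (shuffle ?B ?C) ?A"
      unfolding expand[OF homog abc(3) n] expand[OF homog(2,3,1) abc(1) n']
      by (simp only: rot m3 merge_commute[of a c] merge_commute[of a b] add_ac)
    then show ?thesis by (simp add: p_def q_def r_def uvw)
  qed
qed

section \<open>Associativity for combinations of words with positive letters\<close>

definition proper :: "'a::{finite,field} wordspace \<Rightarrow> bool" where
  "proper p \<longleftrightarrow> keys p \<subseteq> words"

lemma proper_basis [simp]: "u \<in> words \<Longrightarrow> proper (basis u)"
  by (simp add: proper_def keys_basis)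

lemma homog_imp_proper: "homog n p \<Longrightarrow> proper p"
  by (auto simp: proper_def homog_def)

lemma proper_prepend [simp]: "1 \<le> a \<Longrightarrow> proper p \<Longrightarrow> proper (prepend a p)"
  using keys_prepend[of a p] by (fastforce simp: proper_def)

lemma proper_shuffle_word [simp]: "u \<in> words \<Longrightarrow> v \<in> words \<Longrightarrow> proper (shuffle_word u v)"
  by (rule homog_imp_proper[OF homog_shuffle_word])

lemma proper_shuffle [simp]: "proper p \<Longrightarrow> proper r \<Longrightarrow> proper (shuffle p r)"
  unfolding proper_def shuffle_def
  by (rule keys_bilinext) (meson proper_def proper_shuffle_word subsetD)

lemma shuffle_assoc:
  assumes "proper p" "proper r" "proper s"
  shows "shuffle (shuffle p r) s = shuffle p (shuffle r s)"
proof -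
  have "shuffle (shuffle p r) s = shuffle (shuffle r s) p"
    by (rule shuffle_rotate_extend, rule shuffle_rotate_words) (use assms in \<open>auto simp: proper_def\<close>)
  then show ?thesis by (simp add: shuffle_commute)
qed

lemma shuffle_left_commute:
  assumes "proper p" "proper r" "proper s"
  shows "shuffle p (shuffle r s) = shuffle r (shuffle p s)"
  using shuffle_assoc[OF assms] shuffle_assoc[OF assms(2,1,3)] by (simp add: shuffle_commute[of p r])

lemma diamond_prepend: "diamond (prepend a p) (prepend b r) = merge a b (shuffle p r)"
proof (rule bilinext_eqI[where F = "\<lambda>p r. diamond (prepend a p) (prepend b r)"
      and G = "\<lambda>p r. merge a b (shuffle p r)"])
  fix u v
  show "diamond (prepend a (basis u)) (prepend b (basis v)) = merge a b (shuffle (basis u) (basis v))"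
    by (simp only: prepend_basis diamond_def bilinext_basis diamond_word_Cons shuffle_basis)
qed (unfold diamond_def, (intro lin_map_intros lin_map_comp[OF _ lin_map_bilinext_left] lin_map_comp[OF _ lin_map_bilinext_right])+)

lemma triangle_merge:
  assumes "proper p" "proper r"
  shows "triangle (merge a b p) r = merge a b (shuffle p r)"
  using assms by (simp add: merge_def triangle_left triangle_prepend shuffle_assoc)

section \<open>The tensor square\<close>

lemma lin_map_tensor_left: "lin_map (\<lambda>p. tensor p r)"
  unfolding tensor_def by (rule lin_map_bilinext_left)

lemma lin_map_tensor_right: "lin_map (tensor p)"
  unfolding tensor_def by (rule lin_map_bilinext_right)

lemmas tensor_left = lin_map_add[OF lin_map_tensor_left] lin_map_diff[OF lin_map_tensor_left]
  lin_map_smul[OF lin_map_tensor_left] lin_map_sum[OF lin_map_tensor_left]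
  lin_map_zero[OF lin_map_tensor_left]

lemmas tensor_right = lin_map_add[OF lin_map_tensor_right] lin_map_diff[OF lin_map_tensor_right]
  lin_map_smul[OF lin_map_tensor_right] lin_map_sum[OF lin_map_tensor_right]
  lin_map_zero[OF lin_map_tensor_right]

lemma tensor_basis: "tensor (basis u) (basis v) = basis (u, v)"
  by (simp add: tensor_def)

lemma keys_tensor: "keys (tensor p r) \<subseteq> keys p \<times> keys r"
  unfolding tensor_def by (rule keys_bilinext) (auto simp: keys_basis)

text \<open>Right factors are always shuffled; only the operation on left factors varies. Shuffle,
  triangle and diamond thus share one set of rules.\<close>

definition tensor_op :: "(word \<Rightarrow> word \<Rightarrow> 'a::{finite,field} wordspace)
    \<Rightarrow> 'a tensorspace \<Rightarrow> 'a tensorspace \<Rightarrow> 'a tensorspace" where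
  "tensor_op f = bilinext (\<lambda>(u1, v1) (u2, v2). tensor (f u1 u2) (shuffle_word v1 v2))"

lemma lin_map_tensor_op_left: "lin_map (\<lambda>X. tensor_op f X Y)"
  unfolding tensor_op_def by (rule lin_map_bilinext_left)

lemma lin_map_tensor_op_right: "lin_map (tensor_op f X)"
  unfolding tensor_op_def by (rule lin_map_bilinext_right)

lemmas tensor_op_left = lin_map_add[OF lin_map_tensor_op_left] lin_map_diff[OF lin_map_tensor_op_left]
  lin_map_smul[OF lin_map_tensor_op_left] lin_map_sum[OF lin_map_tensor_op_left]
  lin_map_zero[OF lin_map_tensor_op_left]

lemmas tensor_op_right = lin_map_add[OF lin_map_tensor_op_right] lin_map_diff[OF lin_map_tensor_op_right]
  lin_map_smul[OF lin_map_tensor_op_right] lin_map_sum[OF lin_map_tensor_op_right]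
  lin_map_zero[OF lin_map_tensor_op_right]

lemmas lin_map_tensor_intros = lin_map_id lin_map_plus
  lin_map_comp[OF _ lin_map_tensor_left] lin_map_comp[OF _ lin_map_tensor_right]
  lin_map_comp[OF _ lin_map_tensor_op_left] lin_map_comp[OF _ lin_map_tensor_op_right]
  lin_map_comp[OF _ lin_map_shuffle_left] lin_map_comp[OF _ lin_map_shuffle_right]
  lin_map_comp[OF _ lin_map_bilinext_left] lin_map_comp[OF _ lin_map_bilinext_right]

lemma tensor_op_basis: "tensor_op f (basis (u, v)) (basis (u', v')) = tensor (f u u') (shuffle_word v v')"
  by (simp add: tensor_op_def)

lemma tensor_op_tensor:
  "tensor_op f (tensor p r) (tensor p' r') = tensor (bilinext f p p') (shuffle r r')"
proof (rule bilinext_eqI[where F = "\<lambda>p r. tensor_op f (tensor p r) (tensor p' r')"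
      and G = "\<lambda>p r. tensor (bilinext f p p') (shuffle r r')"])
  fix u v
  show "tensor_op f (tensor (basis u) (basis v)) (tensor p' r') = tensor (bilinext f (basis u) p') (shuffle (basis v) r')"
  proof (rule bilinext_eqI[where F = "\<lambda>p' r'. tensor_op f (tensor (basis u) (basis v)) (tensor p' r')"
        and G = "\<lambda>p' r'. tensor (bilinext f (basis u) p') (shuffle (basis v) r')"])
    fix u' v'
    show "tensor_op f (tensor (basis u) (basis v)) (tensor (basis u') (basis v'))
        = tensor (bilinext f (basis u) (basis u')) (shuffle (basis v) (basis v'))"
      by (simp only: tensor_basis tensor_op_basis bilinext_basis shuffle_basis)
  qed (intro lin_map_tensor_intros)+
qed (intro lin_map_tensor_intros)+

abbreviation "ten_shuffle \<equiv> tensor_op shuffle_word"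
abbreviation "ten_triangle \<equiv> tensor_op triangle_word"
abbreviation "ten_diamond \<equiv> tensor_op diamond_word"

lemma tensor_shuffle_eq: "tensor_shuffle = ten_shuffle"
  and tensor_triangle_shuffle_eq: "tensor_triangle_shuffle = ten_triangle"
  unfolding tensor_shuffle_def tensor_triangle_shuffle_def tensor_op_def by (rule refl)+

lemma ten_shuffle_tensor: "ten_shuffle (tensor p r) (tensor p' r') = tensor (shuffle p p') (shuffle r r')"
  and ten_triangle_tensor: "ten_triangle (tensor p r) (tensor p' r') = tensor (triangle p p') (shuffle r r')"
  and ten_diamond_tensor: "ten_diamond (tensor p r) (tensor p' r') = tensor (diamond p p') (shuffle r r')"
  by (simp_all add: tensor_op_tensor shuffle_def triangle_def diamond_def)

lemmas ten_tensor = ten_shuffle_tensor ten_triangle_tensor ten_diamond_tensor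

text \<open>For an empty left word the triangle product degenerates to its second argument, and laws
  such as \<open>ten_triangle_triangle\<close> fail; hence the restriction to these pairs.\<close>

abbreviation positive_left :: "(word \<times> word) set" where
  "positive_left \<equiv> (words - {[]}) \<times> words"

lemma positive_leftE:
  assumes "x \<in> positive_left"
  obtains a u s where "x = (a # u, s)" "1 \<le> a" "u \<in> words" "s \<in> words"
proof -
  obtain w s where x: "x = (w, s)" by (cases x)
  show thesis using assms that by (cases w) (auto simp: x)
qed

lemma ten_shuffle_commute: "ten_shuffle X Y = ten_shuffle Y X"
proof (rule bilinext_eqI[where F = "\<lambda>X Y. ten_shuffle X Y" and G = "\<lambda>X Y. ten_shuffle Y X"])
  fix x y :: "word \<times> word"
  show "ten_shuffle (basis x) (basis y) = ten_shuffle (basis y) (basis x)"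
    by (cases x; cases y) (simp add: tensor_op_basis shuffle_word_commute)
qed (intro lin_map_tensor_intros)+

lemma ten_shuffle_assoc:
  assumes "keys X \<subseteq> words \<times> words" "keys Y \<subseteq> words \<times> words" "keys Z \<subseteq> words \<times> words"
  shows "ten_shuffle (ten_shuffle X Y) Z = ten_shuffle X (ten_shuffle Y Z)"
proof (rule lin_map_eqI[where F = "\<lambda>X. ten_shuffle (ten_shuffle X Y) Z" and G = "\<lambda>X. ten_shuffle X (ten_shuffle Y Z)"])
  fix x assume x: "x \<in> keys X"
  show "ten_shuffle (ten_shuffle (basis x) Y) Z = ten_shuffle (basis x) (ten_shuffle Y Z)"
  proof (rule bilinext_eqI[where F = "\<lambda>Y Z. ten_shuffle (ten_shuffle (basis x) Y) Z"
        and G = "\<lambda>Y Z. ten_shuffle (basis x) (ten_shuffle Y Z)"])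
    fix y z assume "y \<in> keys Y" "z \<in> keys Z"
    with x have "x \<in> words \<times> words" "y \<in> words \<times> words" "z \<in> words \<times> words" using assms by blast+
    then show "ten_shuffle (ten_shuffle (basis x) (basis y)) (basis z) = ten_shuffle (basis x) (ten_shuffle (basis y) (basis z))"
      by (auto simp: ten_tensor shuffle_assoc simp flip: tensor_basis)
  qed (intro lin_map_tensor_intros)+
qed (intro lin_map_tensor_intros)+

text \<open>Behind the first letter everything is shuffled, so this reduces to associativity of the
  shuffle product.\<close>

lemma ten_triangle_triangle:
  assumes "keys A \<subseteq> positive_left" "keys X \<subseteq> words \<times> words" "keys Y \<subseteq> words \<times> words"
  shows "ten_triangle (ten_triangle A X) Y = ten_triangle A (ten_shuffle X Y)"
proof (rule lin_map_eqI[where F = "\<lambda>A. ten_triangle (ten_triangle A X) Y" and G = "\<lambda>A. ten_triangle A (ten_shuffle X Y)"])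
  fix x assume "x \<in> keys A"
  then have "x \<in> positive_left" using assms(1) by blast
  then obtain a u s where x: "x = (a # u, s)" "u \<in> words" "s \<in> words"
    by (rule positive_leftE)
  show "ten_triangle (ten_triangle (basis x) X) Y = ten_triangle (basis x) (ten_shuffle X Y)"
  proof (rule bilinext_eqI[where F = "\<lambda>X Y. ten_triangle (ten_triangle (basis x) X) Y"
        and G = "\<lambda>X Y. ten_triangle (basis x) (ten_shuffle X Y)"])
    fix y z assume "y \<in> keys X" "z \<in> keys Y"
    then have "y \<in> words \<times> words" "z \<in> words \<times> words" using assms by blast+
    then show "ten_triangle (ten_triangle (basis x) (basis y)) (basis z) = ten_triangle (basis x) (ten_shuffle (basis y) (basis z))"
      using x by (auto simp: ten_tensor shuffle_assoc triangle_prepend simp flip: tensor_basis prepend_basis)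
  qed (intro lin_map_tensor_intros)+
qed (intro lin_map_tensor_intros)+

text \<open>The factor 1 leaves the left words alone, and the right factors only have to be
  commuted.\<close>

lemma ten_shuffle_one_triangle:
  assumes "proper p" "keys A \<subseteq> positive_left" "keys X \<subseteq> words \<times> words"
  shows "ten_shuffle (tensor (basis []) p) (ten_triangle A X) = ten_triangle A (ten_shuffle (tensor (basis []) p) X)"
proof (rule bilinext_eqI[where F = "\<lambda>A X. ten_shuffle (tensor (basis []) p) (ten_triangle A X)"
      and G = "\<lambda>A X. ten_triangle A (ten_shuffle (tensor (basis []) p) X)"])
  fix x y assume "x \<in> keys A" "y \<in> keys X"
  then have "x \<in> positive_left" "y \<in> words \<times> words" using assms by blast+
  then show "ten_shuffle (tensor (basis []) p) (ten_triangle (basis x) (basis y))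
      = ten_triangle (basis x) (ten_shuffle (tensor (basis []) p) (basis y))"
    using assms(1) by (auto simp: ten_tensor shuffle_left_commute simp flip: tensor_basis)
qed (intro lin_map_tensor_intros)+

text \<open>This is \<open>shuffle_prepend\<close> for the tails \<open>shuffle p x\<close> and
  \<open>shuffle r y\<close>, regrouped by associativity and commutativity.\<close>

lemma shuffle_triangle:
  assumes "proper p" "proper r" "proper x" "proper y" and ab: "1 \<le> a" "1 \<le> b"
  shows "shuffle (triangle (prepend a p) x) (triangle (prepend b r) y)
    = triangle (prepend a p) (shuffle x (triangle (prepend b r) y))
    + triangle (prepend b r) (shuffle (triangle (prepend a p) x) y)
    + triangle (diamond (prepend a p) (prepend b r)) (shuffle x y)"
proof -
  have "shuffle (shuffle p x) (prepend b (shuffle r y)) = shuffle p (shuffle x (prepend b (shuffle r y)))"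
    "shuffle (prepend a (shuffle p x)) (shuffle r y) = shuffle r (shuffle (prepend a (shuffle p x)) y)"
    using assms by (simp_all add: shuffle_assoc shuffle_left_commute)
  moreover have "shuffle (shuffle p x) (shuffle r y) = shuffle (shuffle p r) (shuffle x y)"
    using assms by (simp add: shuffle_assoc shuffle_left_commute)
  ultimately show ?thesis
    using assms by (simp add: triangle_prepend diamond_prepend triangle_merge shuffle_prepend)
qed

lemma ten_shuffle_triangle:
  assumes A: "keys A \<subseteq> positive_left" and B: "keys B \<subseteq> positive_left"
    and X: "keys X \<subseteq> words \<times> words" and Y: "keys Y \<subseteq> words \<times> words"
  shows "ten_shuffle (ten_triangle A X) (ten_triangle B Y) = ten_triangle A (ten_shuffle X (ten_triangle B Y))
    + ten_triangle B (ten_shuffle (ten_triangle A X) Y) + ten_triangle (ten_diamond A B) (ten_shuffle X Y)"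
proof (rule bilinext_eqI[where F = "\<lambda>A B. ten_shuffle (ten_triangle A X) (ten_triangle B Y)"
      and G = "\<lambda>A B. ten_triangle A (ten_shuffle X (ten_triangle B Y))
        + ten_triangle B (ten_shuffle (ten_triangle A X) Y) + ten_triangle (ten_diamond A B) (ten_shuffle X Y)"])
  fix s t assume "s \<in> keys A" "t \<in> keys B"
  then have "s \<in> positive_left" "t \<in> positive_left" using A B by blast+
  from this(1) obtain a u s' where s: "s = (a # u, s')" "1 \<le> a" "u \<in> words" "s' \<in> words"
    by (rule positive_leftE)
  from \<open>t \<in> positive_left\<close> obtain b v t' where t: "t = (b # v, t')" "1 \<le> b" "v \<in> words" "t' \<in> words"
    by (rule positive_leftE)
  show "ten_shuffle (ten_triangle (basis s) X) (ten_triangle (basis t) Y) = ten_triangle (basis s) (ten_shuffle X (ten_triangle (basis t) Y))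
    + ten_triangle (basis t) (ten_shuffle (ten_triangle (basis s) X) Y) + ten_triangle (ten_diamond (basis s) (basis t)) (ten_shuffle X Y)"
  proof (rule bilinext_eqI[where F = "\<lambda>X Y. ten_shuffle (ten_triangle (basis s) X) (ten_triangle (basis t) Y)"
      and G = "\<lambda>X Y. ten_triangle (basis s) (ten_shuffle X (ten_triangle (basis t) Y))
        + ten_triangle (basis t) (ten_shuffle (ten_triangle (basis s) X) Y) + ten_triangle (ten_diamond (basis s) (basis t)) (ten_shuffle X Y)"])
    fix xs yt assume "xs \<in> keys X" "yt \<in> keys Y"
    then have "xs \<in> words \<times> words" "yt \<in> words \<times> words" using X Y by blast+
    then obtain x x' y y' where xy: "xs = (x, x')" "yt = (y, y')" and words: "x \<in> words" "x' \<in> words" "y \<in> words" "y' \<in> words"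
      by blast
    \<comment> \<open>The right factors of all terms are products of the same four words in
      different orders, so only the left factors need \<open>shuffle_triangle\<close>.\<close>
    have right: "shuffle (basis s') (shuffle (basis x') (shuffle (basis t') (basis y')))
        = shuffle (shuffle (basis s') (basis x')) (shuffle (basis t') (basis y'))"
      "shuffle (basis t') (shuffle (shuffle (basis s') (basis x')) (basis y'))
        = shuffle (shuffle (basis s') (basis x')) (shuffle (basis t') (basis y'))"
      "shuffle (shuffle (basis s') (basis t')) (shuffle (basis x') (basis y'))
        = shuffle (shuffle (basis s') (basis x')) (shuffle (basis t') (basis y'))"
      using words s t by (simp_all add: shuffle_assoc shuffle_left_commute)
    show "ten_shuffle (ten_triangle (basis s) (basis xs)) (ten_triangle (basis t) (basis yt))
        = ten_triangle (basis s) (ten_shuffle (basis xs) (ten_triangle (basis t) (basis yt)))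
        + ten_triangle (basis t) (ten_shuffle (ten_triangle (basis s) (basis xs)) (basis yt))
        + ten_triangle (ten_diamond (basis s) (basis t)) (ten_shuffle (basis xs) (basis yt))"
      unfolding s(1) t(1) xy tensor_basis[symmetric] prepend_basis[symmetric] ten_tensor right
      by (subst shuffle_triangle) (use words s t in \<open>simp_all add: tensor_left\<close>)
  qed (intro lin_map_tensor_intros)+
qed (intro lin_map_tensor_intros)+

section \<open>The coproduct\<close>

declare coproduct_word.simps [simp del]

lemma lin_map_coproduct: "lin_map coproduct"
  unfolding coproduct_def by (rule lin_map_linext)

lemmas coproduct_lin = lin_map_add[OF lin_map_coproduct] lin_map_diff[OF lin_map_coproduct]
  lin_map_smul[OF lin_map_coproduct] lin_map_sum[OF lin_map_coproduct] lin_map_zero[OF lin_map_coproduct]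

lemma coproduct_basis: "coproduct (basis u) = coproduct_word u"
  by (simp add: coproduct_def)

abbreviation one_tensor :: "'a::{finite,field} wordspace \<Rightarrow> 'a tensorspace" where
  "one_tensor \<equiv> tensor (basis [])"

section \<open>Terms of the coproduct with nonempty left factor\<close>

lemma keys_ten_shuffle_positive:
  fixes X Y :: "'a::{finite,field} tensorspace"
  assumes X: "keys X \<subseteq> positive_left" and Y: "keys Y \<subseteq> words \<times> words"
  shows "keys (ten_shuffle X Y) \<subseteq> positive_left"
  unfolding tensor_op_def
proof (rule keys_bilinext)
  fix x y assume "x \<in> keys X" "y \<in> keys Y"
  then have "x \<in> positive_left" "y \<in> words \<times> words" using X Y by blast+
  then obtain u s v t where xy: "x = (u, s)" "y = (v, t)" "u \<noteq> []" "u \<in> words" "s \<in> words" "v \<in> words" "t \<in> words"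
    by auto
  \<comment> \<open>Weight is preserved and \<open>u\<close> has positive weight, so the empty word
    cannot occur.\<close>
  have "keys (shuffle_word u v :: 'a wordspace) \<subseteq> words - {[]}"
  proof
    fix w assume "w \<in> keys (shuffle_word u v :: 'a wordspace)"
    then have "w \<in> words \<and> sum_list w = sum_list u + sum_list v"
      using homog_shuffle_word[of u v, where 'a = 'a] xy unfolding homog_def by blast
    moreover have "sum_list u \<noteq> 0" using sum_list_words_eq_0[of u] xy by simp
    ultimately show "w \<in> words - {[]}" by (cases w) auto
  qed
  moreover have "keys (shuffle_word s t :: 'a wordspace) \<subseteq> words"
    using proper_shuffle_word[of s t] xy by (simp add: proper_def)
  ultimately have "keys (tensor (shuffle_word u v) (shuffle_word s t) :: 'a tensorspace) \<subseteq> positive_left"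
    using keys_tensor[of "shuffle_word u v :: 'a wordspace" "shuffle_word s t"] by blast
  then show "keys ((case x of (u1, v1) \<Rightarrow> \<lambda>(u2, v2). tensor (shuffle_word u1 u2) (shuffle_word v1 v2)) y :: 'a tensorspace) \<subseteq> positive_left"
    by (simp add: xy)
qed

lemma keys_ten_triangle_positive:
  fixes X Y :: "'a::{finite,field} tensorspace"
  assumes X: "keys X \<subseteq> positive_left" and Y: "keys Y \<subseteq> words \<times> words"
  shows "keys (ten_triangle X Y) \<subseteq> positive_left"
  unfolding tensor_op_def
proof (rule keys_bilinext)
  fix x y assume "x \<in> keys X" "y \<in> keys Y"
  then have x: "x \<in> positive_left" and y: "y \<in> words \<times> words" using X Y by blast+
  from x obtain a u s where x: "x = (a # u, s)" "1 \<le> a" "u \<in> words" "s \<in> words"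
    by (rule positive_leftE)
  from y obtain v t where y: "y = (v, t)" "v \<in> words" "t \<in> words" by auto
  have "keys (triangle_word (a # u) v :: 'a wordspace) \<subseteq> words - {[]}"
    using keys_prepend[of a "shuffle_word u v :: 'a wordspace"]
      proper_prepend[OF x(2) proper_shuffle_word[OF x(3) y(2)], where 'a = 'a]
    unfolding triangle_word_Cons proper_def by blast
  moreover have "keys (shuffle_word s t :: 'a wordspace) \<subseteq> words"
    using proper_shuffle_word[of s t] x y by (simp add: proper_def)
  ultimately have "keys (tensor (triangle_word (a # u) v) (shuffle_word s t) :: 'a tensorspace) \<subseteq> positive_left"
    using keys_tensor[of "triangle_word (a # u) v :: 'a wordspace" "shuffle_word s t"] by blast
  then show "keys ((case x of (u1, v1) \<Rightarrow> \<lambda>(u2, v2). tensor (triangle_word u1 u2) (shuffle_word v1 v2)) y :: 'a tensorspace) \<subseteq> positive_left"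
    by (simp add: x y)
qed

text \<open>The shape expected of a coproduct \<open>X\<close> of \<open>p\<close>, stated for
  arbitrary pairs so that it is closed under the operations in the recursion of
  \<open>coproduct_word\<close>.\<close>

definition lifts :: "'a::{finite,field} wordspace \<Rightarrow> 'a tensorspace \<Rightarrow> bool" where
  "lifts p X \<longleftrightarrow> proper p \<and> keys (X - one_tensor p) \<subseteq> positive_left"

lemma keys_one_tensor:
  assumes "proper p"
  shows "keys (one_tensor p) \<subseteq> words \<times> words"
  using keys_tensor[of "basis []" p] assms by (auto simp: keys_basis proper_def)

lemma lifts_keys:
  assumes "lifts p X"
  shows "keys X \<subseteq> words \<times> words"
proof -
  have "keys (X - one_tensor p + one_tensor p) \<subseteq> words \<times> words"
    using assms keys_one_tensor[of p] unfolding lifts_def by (intro keys_plus_subset) auto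
  then show ?thesis by simp
qed

lemma lifts_minus: "lifts p X \<Longrightarrow> lifts r Y \<Longrightarrow> lifts (p - r) (X - Y)"
  unfolding lifts_def proper_def
  using keys_minus_subset[of p words r] keys_minus_subset[of "X - one_tensor p" positive_left "Y - one_tensor r"]
  by (simp add: tensor_right algebra_simps)

lemma lifts_smul: "lifts p X \<Longrightarrow> lifts (smul c p) (smul c X)"
  unfolding lifts_def proper_def
  using keys_smul_subset[of p words c] keys_smul_subset[of "X - one_tensor p" positive_left c]
  by (simp add: tensor_right smul_diff)

lemma lifts_sum:
  assumes "\<And>i. i \<in> I \<Longrightarrow> lifts (f i) (g i)"
  shows "lifts (\<Sum>i\<in>I. f i) (\<Sum>i\<in>I. g i)"
  unfolding lifts_def proper_def
proof
  show "keys (\<Sum>i\<in>I. f i) \<subseteq> words"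
    using assms by (intro keys_sum_subset) (simp add: lifts_def proper_def)
  have "keys (\<Sum>i\<in>I. g i - one_tensor (f i)) \<subseteq> positive_left"
    using assms by (intro keys_sum_subset) (simp add: lifts_def)
  then show "keys ((\<Sum>i\<in>I. g i) - one_tensor (\<Sum>i\<in>I. f i)) \<subseteq> positive_left"
    by (simp add: tensor_right sum_subtractf)
qed

text \<open>With \<open>P = one_tensor p\<close> and \<open>R = one_tensor r\<close>, the difference
  \<open>X Y - P R\<close> is \<open>(X - P) Y + (Y - R) P\<close>, and each term contains a factor
  with nonempty left words.\<close>

lemma lifts_shuffle:
  assumes "lifts p X" "lifts r Y"
  shows "lifts (shuffle p r) (ten_shuffle X Y)"
proof -
  have pr: "proper p" "proper r" and pos: "keys (X - one_tensor p) \<subseteq> positive_left" "keys (Y - one_tensor r) \<subseteq> positive_left"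
    using assms by (simp_all add: lifts_def)
  have "ten_shuffle X Y - one_tensor (shuffle p r)
      = ten_shuffle (X - one_tensor p) Y + ten_shuffle (Y - one_tensor r) (one_tensor p)"
    unfolding ten_shuffle_commute[of "Y - one_tensor r"]
    by (simp add: tensor_op_left tensor_op_right ten_shuffle_tensor)
  moreover have "keys \<dots> \<subseteq> positive_left"
    by (intro keys_plus_subset keys_ten_shuffle_positive pos lifts_keys[OF assms(2)] keys_one_tensor pr)
  ultimately show ?thesis using pr by (simp add: lifts_def)
qed

text \<open>This matches the clause of \<open>coproduct_word\<close> for a letter of weight at least
  two, term by term.\<close>

lemma letter_eq_shuffle:
  assumes "2 \<le> w"
  shows "letter w = shuffle (letter 1) (letter (w - 1)) - basis [1, w - 1] - basis [w - 1, 1]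
    - (\<Sum>j\<in>{0<..<w}. smul (delta_coeff 1 (w - 1) j) (basis [w - j, j]))"
proof -
  have "1 + (w - 1) = w" and "{1..<w} = {0<..<w}" using assms by auto
  then show ?thesis
    unfolding shuffle_basis shuffle_word_Cons by (simp add: merge_def)
qed

lemma lifts_coproduct_word:
  "u \<in> words \<Longrightarrow> lifts (basis u) (coproduct_word u :: 'a::{finite,field} tensorspace)"
proof (induction u rule: coproduct_word.induct)
  case 1
  then show ?case by (simp add: lifts_def coproduct_word.simps tensor_basis)
next
  case (2 w)
  show ?case
  proof (cases "w = 1")
    case True
    have "coproduct_word [w] - one_tensor (letter w) = (basis ([1], []) :: 'a tensorspace)"
      using True by (simp add: coproduct_word.simps tensor_basis)
    then show ?thesis using True by (simp add: lifts_def keys_basis)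
  next
    case False
    then have w: "w \<noteq> 0" "w \<noteq> 1" "2 \<le> w" using 2 by auto
    have eq: "(coproduct_word [w] :: 'a tensorspace) = ten_shuffle (coproduct_word [1]) (coproduct_word [w - 1])
         - coproduct_word [1, w - 1] - coproduct_word [w - 1, 1]
         - (\<Sum>j \<in> {0<..<w}. smul (delta_coeff 1 (w - 1) j) (coproduct_word [w - j, j]))"
      using w by (simp add: coproduct_word.simps(2)[of w] tensor_shuffle_eq)
    show ?thesis
      unfolding eq letter_eq_shuffle[OF w(3)]
      by (intro lifts_minus lifts_shuffle lifts_sum lifts_smul "2.IH") (use w in auto)
  qed
next
  case (3 u v vs)
  have u: "keys (coproduct_word [u] - basis ([], [u]) :: 'a tensorspace) \<subseteq> positive_left"
    using 3 by (simp add: lifts_def tensor_basis)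
  moreover have "keys (coproduct_word (v # vs) :: 'a tensorspace) \<subseteq> words \<times> words"
    using 3 by (intro lifts_keys[of "basis (v # vs)"]) simp
  ultimately show ?case
    using 3 keys_ten_triangle_positive
    by (simp add: lifts_def coproduct_word.simps(3) tensor_triangle_shuffle_eq tensor_basis)
qed

lemma keys_coproduct:
  assumes "proper p"
  shows "keys (coproduct p) \<subseteq> words \<times> words"
proof -
  have "keys (coproduct_word u) \<subseteq> words \<times> words" if "u \<in> keys p" for u
    using that assms by (intro lifts_keys[OF lifts_coproduct_word]) (auto simp: proper_def)
  then show ?thesis
    unfolding coproduct_def using keys_linext[of coproduct_word p] by blast
qed

text \<open>The \<open>T\<^sub>a\<close> of the introduction.\<close>

definition letter_part :: "nat \<Rightarrow> 'a::{finite,field} tensorspace" where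
  "letter_part a = coproduct_word [a] - basis ([], [a])"

lemma keys_letter_part: "1 \<le> a \<Longrightarrow> keys (letter_part a) \<subseteq> positive_left"
  using lifts_coproduct_word[of "[a]"] by (simp add: lifts_def letter_part_def tensor_basis)

lemma ten_triangle_one [simp]:
  fixes X :: "'a::{finite,field} tensorspace"
  shows "ten_triangle X (basis ([], [])) = X"
proof (rule lin_map_eqI[where F = "\<lambda>X. ten_triangle X (basis ([], []))" and G = "\<lambda>X. X"])
  fix x :: "word \<times> word"
  have "triangle_word u [] = (basis u :: 'a wordspace)" for u by (cases u) simp_all
  then show "ten_triangle (basis x) (basis ([], [])) = (basis x :: 'a tensorspace)"
    by (cases x) (simp add: tensor_op_basis tensor_basis)
qed (intro lin_map_tensor_intros)+

lemma ten_shuffle_one [simp]: "ten_shuffle X (basis ([], [])) = X" "ten_shuffle (basis ([], [])) X = X"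
proof -
  show "ten_shuffle X (basis ([], [])) = X"
  proof (rule lin_map_eqI[where F = "\<lambda>X. ten_shuffle X (basis ([], []))" and G = "\<lambda>X. X"])
    fix x :: "word \<times> word"
    show "ten_shuffle (basis x) (basis ([], [])) = basis x"
      by (cases x) (simp add: tensor_op_basis tensor_basis)
  qed (intro lin_map_tensor_intros)+
  then show "ten_shuffle (basis ([], [])) X = X" by (simp only: ten_shuffle_commute[of _ X])
qed

section \<open>Expansion by first letters\<close>

lemma coproduct_Nil [simp]: "coproduct (basis []) = basis ([], [])"
  by (simp add: coproduct_basis coproduct_word.simps)

text \<open>Letters and longer words are covered at once: for an empty tail, the triangle product
  with \<open>basis ([], [])\<close> is the identity.\<close>

lemma coproduct_prepend:
  "coproduct (prepend a p) = one_tensor (prepend a p) + ten_triangle (letter_part a) (coproduct p)"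
proof (rule lin_map_eqI[where F = "\<lambda>p. coproduct (prepend a p)"
      and G = "\<lambda>p. one_tensor (prepend a p) + ten_triangle (letter_part a) (coproduct p)"])
  fix u
  show "coproduct (prepend a (basis u)) = one_tensor (prepend a (basis u)) + ten_triangle (letter_part a) (coproduct (basis u))"
    by (cases u) (simp_all add: coproduct_basis tensor_basis letter_part_def coproduct_word.simps(1,3)
        tensor_triangle_shuffle_eq)
qed (intro lin_map_tensor_intros lin_map_comp[OF _ lin_map_coproduct] lin_map_comp[OF _ lin_map_prepend] lin_map_coproduct)+

text \<open>The parts with left factor 1 recombine by linearity into a single term; each term of the
  shuffle recursion leaves one triangle product.\<close>

lemma coproduct_shuffle_prepend:
  "coproduct (shuffle (prepend a p) (prepend b r)) = one_tensor (shuffle (prepend a p) (prepend b r))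
    + ten_triangle (letter_part a) (coproduct (shuffle p (prepend b r)))
    + ten_triangle (letter_part b) (coproduct (shuffle (prepend a p) r))
    + (ten_triangle (letter_part (a + b)) (coproduct (shuffle p r))
      + (\<Sum>j\<in>{1..<a + b}. smul (delta_coeff a b j)
          (ten_triangle (letter_part (a + b - j)) (coproduct (shuffle (letter j) (shuffle p r))))))"
  unfolding shuffle_prepend merge_def
  by (simp add: coproduct_lin coproduct_prepend tensor_right smul_add sum.distrib algebra_simps)

text \<open>Both coproducts are split by \<open>coproduct_prepend\<close> and multiplied out. The
  mixed products complete the first two terms of \<open>ten_shuffle_triangle\<close> to full
  coproducts, which matches the expansion of the other side except in the diamond term.\<close>

lemma ten_shuffle_coproduct_prepend:
  assumes "proper p" "proper r" "1 \<le> a" "1 \<le> b"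
  shows "ten_shuffle (coproduct (prepend a p)) (coproduct (prepend b r)) = one_tensor (shuffle (prepend a p) (prepend b r))
    + ten_triangle (letter_part a) (ten_shuffle (coproduct p) (coproduct (prepend b r)))
    + ten_triangle (letter_part b) (ten_shuffle (coproduct (prepend a p)) (coproduct r))
    + ten_triangle (ten_diamond (letter_part a) (letter_part b)) (ten_shuffle (coproduct p) (coproduct r))"
proof -
  let ?a = "letter_part a" and ?b = "letter_part b" and ?A = "one_tensor (prepend a p)" and ?B = "one_tensor (prepend b r)"
  let ?P = "coproduct p" and ?R = "coproduct r"
  have pos: "keys ?a \<subseteq> positive_left" "keys ?b \<subseteq> positive_left"
    using assms keys_letter_part by blast+
  have keys: "keys ?P \<subseteq> words \<times> words" "keys ?R \<subseteq> words \<times> words"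
    using assms keys_coproduct by blast+
  have "ten_shuffle (coproduct (prepend a p)) (coproduct (prepend b r))
      = ten_shuffle ?A ?B + ten_shuffle ?A (ten_triangle ?b ?R) + ten_shuffle ?B (ten_triangle ?a ?P)
        + ten_shuffle (ten_triangle ?a ?P) (ten_triangle ?b ?R)"
    unfolding coproduct_prepend ten_shuffle_commute[of ?B]
    by (simp add: tensor_op_left tensor_op_right)
  also have "ten_shuffle ?A (ten_triangle ?b ?R) = ten_triangle ?b (ten_shuffle ?A ?R)"
    using assms by (intro ten_shuffle_one_triangle pos keys) simp
  also have "ten_shuffle ?B (ten_triangle ?a ?P) = ten_triangle ?a (ten_shuffle ?P ?B)"
    unfolding ten_shuffle_commute[of ?P ?B] using assms by (intro ten_shuffle_one_triangle pos keys) simp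
  also have "ten_shuffle (ten_triangle ?a ?P) (ten_triangle ?b ?R) = ten_triangle ?a (ten_shuffle ?P (ten_triangle ?b ?R))
      + ten_triangle ?b (ten_shuffle (ten_triangle ?a ?P) ?R) + ten_triangle (ten_diamond ?a ?b) (ten_shuffle ?P ?R)"
    by (intro ten_shuffle_triangle pos keys)
  finally show ?thesis
    unfolding coproduct_prepend
    by (simp add: tensor_op_left tensor_op_right ten_shuffle_tensor)
qed

text \<open>Compatibility for the letters \<open>a\<close> and \<open>b\<close> is equivalent to a formula for the diamond product
  of the letter parts, and that formula gives the step to words beginning with \<open>a\<close> and \<open>b\<close>.\<close>

lemma letter_part_diamond:
  assumes hom: "(coproduct (shuffle (letter a) (letter b)) :: 'a::{finite,field} tensorspace)
      = ten_shuffle (coproduct (letter a)) (coproduct (letter b))"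
    and ab: "1 \<le> a" "1 \<le> b"
  shows "(ten_diamond (letter_part a) (letter_part b) :: 'a tensorspace) = letter_part (a + b)
    + (\<Sum>j\<in>{1..<a + b}. smul (delta_coeff a b j) (ten_triangle (letter_part (a + b - j)) (coproduct (letter j))))"
proof -
  let ?X = "one_tensor (shuffle (letter a) (letter b)) + ten_triangle (letter_part a) (coproduct (letter b))
    + ten_triangle (letter_part b) (coproduct (letter a))"
  have 1: "(coproduct (shuffle (letter a) (letter b)) :: 'a tensorspace) = ?X + (letter_part (a + b)
    + (\<Sum>j\<in>{1..<a + b}. smul (delta_coeff a b j) (ten_triangle (letter_part (a + b - j)) (coproduct (letter j)))))"
    using coproduct_shuffle_prepend[of a "basis []" b "basis []"] by simp
  have 2: "(ten_shuffle (coproduct (letter a)) (coproduct (letter b)) :: 'a tensorspace) = ?X + ten_diamond (letter_part a) (letter_part b)"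
    using ten_shuffle_coproduct_prepend[of "basis []" "basis []" a b] ab by simp
  from trans[OF trans[OF 2[symmetric] hom[symmetric]] 1] show ?thesis
    by (simp only: add_left_cancel)
qed

text \<open>The triangle product with the coproduct of \<open>shuffle p r\<close> is applied to the
  formula for the letter parts. Then \<open>ten_triangle_triangle\<close> turns its summands into
  the remaining terms of \<open>coproduct_shuffle_prepend\<close>.\<close>

lemma coproduct_shuffle_prepend_hom:
  fixes p r :: "'a::{finite,field} wordspace"
  assumes diamond: "(ten_diamond (letter_part a) (letter_part b) :: 'a tensorspace) = letter_part (a + b)
      + (\<Sum>j\<in>{1..<a + b}. smul (delta_coeff a b j) (ten_triangle (letter_part (a + b - j)) (coproduct (letter j))))"
    and pr: "proper p" "proper r" and ab: "1 \<le> a" "1 \<le> b"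
    and hom: "coproduct (shuffle p (prepend b r)) = ten_shuffle (coproduct p) (coproduct (prepend b r))"
      "coproduct (shuffle (prepend a p) r) = ten_shuffle (coproduct (prepend a p)) (coproduct r)"
      "coproduct (shuffle p r) = ten_shuffle (coproduct p) (coproduct r)"
      "\<And>j. j \<in> {1..<a + b} \<Longrightarrow> coproduct (shuffle (letter j) (shuffle p r))
        = ten_shuffle (coproduct (letter j)) (coproduct (shuffle p r))"
  shows "coproduct (shuffle (prepend a p) (prepend b r)) = ten_shuffle (coproduct (prepend a p)) (coproduct (prepend b r))"
proof -
  let ?PR = "coproduct (shuffle p r)"
  have keys: "keys ?PR \<subseteq> words \<times> words"
    using pr by (simp add: keys_coproduct)
  have "ten_triangle (ten_triangle (letter_part (a + b - j)) (coproduct (letter j))) ?PR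
      = ten_triangle (letter_part (a + b - j)) (coproduct (shuffle (letter j) (shuffle p r)))"
    if j: "j \<in> {1..<a + b}" for j
    unfolding hom(4)[OF j] using j
    by (intro ten_triangle_triangle keys keys_letter_part keys_coproduct) auto
  then have "ten_triangle (ten_diamond (letter_part a) (letter_part b)) ?PR
      = ten_triangle (letter_part (a + b)) ?PR
        + (\<Sum>j\<in>{1..<a + b}. smul (delta_coeff a b j)
          (ten_triangle (letter_part (a + b - j)) (coproduct (shuffle (letter j) (shuffle p r)))))"
    unfolding diamond by (simp add: tensor_op_left)
  then show ?thesis
    unfolding coproduct_shuffle_prepend ten_shuffle_coproduct_prepend[OF pr ab] hom(1-3)[symmetric]
    by (simp only:)
qed

section \<open>Compatibility by induction on weight\<close>

lemma coproduct_shuffle_extend: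
  fixes p r :: "'a::{finite,field} wordspace"
  assumes "\<And>u v. u \<in> keys p \<Longrightarrow> v \<in> keys r \<Longrightarrow> (coproduct (shuffle (basis u) (basis v)) :: 'a tensorspace)
    = ten_shuffle (coproduct (basis u)) (coproduct (basis v))"
  shows "coproduct (shuffle p r) = ten_shuffle (coproduct p) (coproduct r)"
  by (rule bilinext_eqI[where F = "\<lambda>p r. coproduct (shuffle p r)" and G = "\<lambda>p r. ten_shuffle (coproduct p) (coproduct r)"])
    (use assms in \<open>auto intro!: lin_map_tensor_intros lin_map_comp[OF _ lin_map_coproduct] lin_map_coproduct
      lin_map_shuffle_left lin_map_shuffle_right\<close>)

text \<open>The defining clause for the coproduct of the letter of weight \<open>b + 1\<close>,
  solved for the product.\<close>

lemma coproduct_shuffle_letter_1: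
  assumes "1 \<le> b"
  shows "(coproduct (shuffle (letter 1) (letter b)) :: 'a::{finite,field} tensorspace)
    = ten_shuffle (coproduct (letter 1)) (coproduct (letter b))"
proof -
  have "(shuffle (letter 1) (letter b) :: 'a wordspace) = letter (Suc b) + basis [1, b] + basis [b, 1]
      + (\<Sum>j\<in>{0<..<Suc b}. smul (delta_coeff 1 b j) (basis [Suc b - j, j]))"
    using letter_eq_shuffle[of "Suc b", symmetric] assms by (simp add: algebra_simps)
  moreover have "(coproduct_word [Suc b] :: 'a tensorspace) = ten_shuffle (coproduct_word [1]) (coproduct_word [b])
      - coproduct_word [1, b] - coproduct_word [b, 1]
      - (\<Sum>j\<in>{0<..<Suc b}. smul (delta_coeff 1 b j) (coproduct_word [Suc b - j, j]))"
    using assms by (subst coproduct_word.simps(2)) (simp add: tensor_shuffle_eq)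
  ultimately show ?thesis
    by (simp add: coproduct_lin coproduct_basis)
qed

lemma coproduct_shuffle_words:
  assumes "u \<in> words" "v \<in> words"
  shows "(coproduct (shuffle (basis u) (basis v)) :: 'a::{finite,field} tensorspace)
    = ten_shuffle (coproduct (basis u)) (coproduct (basis v))"
  using assms
proof (induction "sum_list u + sum_list v" arbitrary: u v rule: less_induct)
  case less
  let ?n = "sum_list u + sum_list v"
  define hom where "hom p r \<longleftrightarrow> coproduct (shuffle p r) = ten_shuffle (coproduct p) (coproduct r)"
    for p r :: "'a wordspace"
  have extend: "hom p r" if "homog i p" "homog j r"
    "\<And>x y. x \<in> words \<Longrightarrow> y \<in> words \<Longrightarrow> sum_list x = i \<Longrightarrow> sum_list y = j \<Longrightarrow> hom (basis x) (basis y)"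
    for p r i j
    unfolding hom_def
  proof (rule coproduct_shuffle_extend, fold hom_def)
    fix x y assume "x \<in> keys p" "y \<in> keys r"
    then have "x \<in> {x \<in> words. sum_list x = i}" "y \<in> {y \<in> words. sum_list y = j}"
      using that(1,2) unfolding homog_def by blast+
    then show "hom (basis x) (basis y)" using that(3) by simp
  qed
  have IH: "hom p r" if "homog i p" "homog j r" "i + j < ?n" for p r i j
    by (rule extend[OF that(1,2)]) (use less.hyps that(3) in \<open>simp add: hom_def\<close>)
  have one: "hom (basis []) p" "hom p (basis [])" for p
    by (simp_all add: hom_def)
  \<comment> \<open>A nonempty tail forces \<open>a + b < ?n\<close>, so the induction hypothesis
    for the two letters supplies the diamond formula of their letter parts.\<close>
  have long: "hom (basis (a # x)) (basis (b # y))"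
    if words: "a # x \<in> words" "b # y \<in> words" and n: "sum_list (a # x) + sum_list (b # y) = ?n"
      and ne: "x \<noteq> [] \<or> y \<noteq> []" for a b x y
  proof -
    have ab: "1 \<le> a" "1 \<le> b" and xy: "x \<in> words" "y \<in> words" using words by auto
    have "0 < sum_list x + sum_list y"
      using ne sum_list_words_eq_0[OF xy(1)] sum_list_words_eq_0[OF xy(2)] by auto
    then have lt: "a + b < ?n" using n unfolding sum_list.Cons by linarith
    have hom_xy: "homog (sum_list x) (basis x)" "homog (sum_list y) (basis y)"
      "homog (a + sum_list x) (prepend a (basis x))" "homog (b + sum_list y) (prepend b (basis y))"
      using xy ab by (simp_all add: homog_basis homog_prepend del: prepend_basis)
    have "hom (letter a) (letter b)"
      using ab lt by (intro IH[of a _ b] homog_letter)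
    then have diamond: "ten_diamond (letter_part a) (letter_part b) = letter_part (a + b)
      + (\<Sum>j\<in>{1..<a + b}. smul (delta_coeff a b j) (ten_triangle (letter_part (a + b - j)) (coproduct (letter j :: 'a wordspace))))"
      unfolding hom_def by (rule letter_part_diamond[OF _ ab])
    have "hom (prepend a (basis x)) (prepend b (basis y))"
      unfolding hom_def
    proof (rule coproduct_shuffle_prepend_hom[OF diamond _ _ ab])
      show "proper (basis x :: 'a wordspace)" "proper (basis y :: 'a wordspace)" using xy by simp_all
      show "coproduct (shuffle (basis x) (prepend b (basis y))) = ten_shuffle (coproduct (basis x)) (coproduct (prepend b (basis y)) :: 'a tensorspace)"
        using IH[OF hom_xy(1,4)] n ab by (simp add: hom_def)
      show "coproduct (shuffle (prepend a (basis x)) (basis y)) = ten_shuffle (coproduct (prepend a (basis x))) (coproduct (basis y) :: 'a tensorspace)"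
        using IH[OF hom_xy(3,2)] n ab by (simp add: hom_def)
      show "coproduct (shuffle (basis x) (basis y)) = ten_shuffle (coproduct (basis x)) (coproduct (basis y) :: 'a tensorspace)"
        using IH[OF hom_xy(1,2)] n ab by (simp add: hom_def)
      show "coproduct (shuffle (letter j) (shuffle (basis x) (basis y)))
          = ten_shuffle (coproduct (letter j)) (coproduct (shuffle (basis x) (basis y)) :: 'a tensorspace)"
        if "j \<in> {1..<a + b}" for j
        using IH[OF homog_letter homog_shuffle[OF hom_xy(1,2)], of j] n that by (simp add: hom_def)
    qed
    then show ?thesis by simp
  qed
  \<comment> \<open>The total weight is \<open>?n\<close>, out of reach of the induction hypothesis.
    Words of \<open>p\<close> with one letter are covered by the definition of the coproduct, longer
    ones by \<open>long\<close>.\<close>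
  have first: "hom (letter 1) p" if p: "homog m p" and m: "1 + m = ?n" for p m
  proof (rule extend[OF homog_letter p])
    fix x y assume xy: "x \<in> words" "y \<in> words" "sum_list x = 1" "sum_list y = m"
    have x: "x = [1]"
    proof (cases x)
      case (Cons c x')
      then have "1 \<le> c" "x' \<in> words" "c + sum_list x' = 1" using xy by auto
      then have "c = 1" "sum_list x' = 0" by linarith+
      then show ?thesis using Cons sum_list_words_eq_0[OF \<open>x' \<in> words\<close>] by simp
    qed (use xy in simp)
    show "hom (basis x) (basis y)"
    proof (cases y)
      case Nil
      then show ?thesis by (simp add: one)
    next
      case (Cons b y')
      show ?thesis
      proof (cases "y' = []")
        case True
        then show ?thesis using coproduct_shuffle_letter_1[of b] xy by (simp add: x Cons hom_def)
      next
        case False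
        then show ?thesis using long[of 1 "[]" b y'] xy m by (simp add: x Cons)
      qed
    qed
  qed simp
  have "hom (basis u) (basis v)"
  proof (cases "u = [] \<or> v = []")
    case True
    then show ?thesis using one by auto
  next
    case False
    then obtain a x b y where uv: "u = a # x" "v = b # y"
      by (meson neq_Nil_conv)
    have ab: "1 \<le> a" "1 \<le> b" using less.prems by (auto simp: uv)
    show ?thesis
    proof (cases "x = [] \<and> y = []")
      case False
      then show ?thesis using long[of a x b y] less.prems by (simp add: uv)
    next
      case True
      then have n: "?n = a + b" by (simp add: uv)
      have "hom (letter a) (letter b)"
      proof (cases "a = 1")
        case True
        then show ?thesis using coproduct_shuffle_letter_1[OF ab(2)] by (simp add: hom_def)
      next
        case False
        then have a: "2 \<le> a" using ab by simp
        \<comment> \<open>\<open>R\<close> collects the words of depth two in the product of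
          \<open>letter 1\<close> and \<open>letter (a - 1)\<close>; paired with
          \<open>letter b\<close>, they fall under \<open>long\<close>.\<close>
        define R where "R = basis [1, a - 1] + basis [a - 1, 1]
            + (\<Sum>j\<in>{0<..<a}. smul (delta_coeff 1 (a - 1) j) (basis [a - j, j] :: 'a wordspace))"
        let ?z = "shuffle (letter (a - 1)) (letter b) :: 'a wordspace"
        have R: "letter a = shuffle (letter 1) (letter (a - 1)) - R"
          using letter_eq_shuffle[OF a] by (simp add: R_def algebra_simps)
        have la: "homog (a - 1) (letter (a - 1))" using a by (intro homog_letter) simp
        have 1: "coproduct (shuffle (letter 1) ?z) = ten_shuffle (coproduct (letter 1)) (coproduct ?z)"
          using first[OF homog_shuffle[OF la homog_letter[OF ab(2)]]] a n by (simp add: hom_def)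
        have 2: "coproduct ?z = ten_shuffle (coproduct (letter (a - 1))) (coproduct (letter b))"
          using IH[OF la homog_letter[OF ab(2)]] a n by (simp add: hom_def)
        have 3: "coproduct (shuffle (letter 1) (letter (a - 1)))
            = ten_shuffle (coproduct (letter 1)) (coproduct (letter (a - 1)) :: 'a tensorspace)"
          by (rule coproduct_shuffle_letter_1) (use a in simp)
        have 4: "coproduct (shuffle R (letter b)) = ten_shuffle (coproduct R) (coproduct (letter b))"
        proof (rule coproduct_shuffle_extend)
          fix x y assume x: "x \<in> keys R" and y: "y \<in> keys (letter b :: 'a wordspace)"
          have "keys R \<subseteq> {[c, d] | c d. 1 \<le> c \<and> 1 \<le> d \<and> c + d = a}"
            unfolding R_def by (intro keys_subset_intros) (use a in \<open>auto simp: keys_basis\<close>)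
          then obtain c d where "x = [c, d]" "1 \<le> c" "1 \<le> d" "c + d = a" using x by blast
          then show "(coproduct (shuffle (basis x) (basis y)) :: 'a tensorspace) = ten_shuffle (coproduct (basis x)) (coproduct (basis y))"
            using long[of c "[d]" b "[]"] y ab n by (simp add: keys_basis hom_def)
        qed
        \<comment> \<open>Associativity isolates the factor \<open>letter 1\<close>, so that
          \<open>first\<close> applies to \<open>?z\<close>, while the inner product has smaller
          weight.\<close>
        have "shuffle (letter a) (letter b) = shuffle (letter 1) ?z - shuffle R (letter b)"
          unfolding R using a ab by (simp add: shuffle_left shuffle_assoc)
        then have "coproduct (shuffle (letter a) (letter b))
            = ten_shuffle (coproduct (letter 1)) (ten_shuffle (coproduct (letter (a - 1))) (coproduct (letter b)))
              - ten_shuffle (coproduct R) (coproduct (letter b))"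
          by (simp only: coproduct_lin 1 2 4)
        also have "\<dots> = ten_shuffle (ten_shuffle (coproduct (letter 1)) (coproduct (letter (a - 1))) - coproduct R) (coproduct (letter b))"
          unfolding tensor_op_left using a ab by (subst ten_shuffle_assoc) (auto intro!: keys_coproduct)
        also have "\<dots> = ten_shuffle (coproduct (letter a)) (coproduct (letter b))"
          unfolding R coproduct_lin 3 ..
        finally show ?thesis unfolding hom_def .
      qed
      then show ?thesis using True by (simp add: uv)
    qed
  qed
  then show ?case by (simp add: hom_def)
qed

theorem theorem7p2:
  fixes \<aa> \<bb> :: word
  assumes "\<aa> \<in> words" and "\<bb> \<in> words"
  shows "(coproduct (shuffle (basis \<aa>) (basis \<bb>)) :: 'a::{finite,field} tensorspace)
       = tensor_shuffle (coproduct (basis \<aa>)) (coproduct (basis \<bb>))"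
  using coproduct_shuffle_words[OF assms] by (simp only: tensor_shuffle_eq)

end
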